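(* Let $r \geq 2$ be a fixed integer and, for each $n \geq 1$, let $\mathcal{A}_n$ be uniformly distributed on $\mathcal{M}(n,r)$. Then $$\left(\chi_1(\mathcal{A}_n), \chi_2(\mathcal{A}_n), \ldots\right) \stackrel{d}{\longrightarrow} (Z_1, Z_2, \ldots) \quad \text{as } n \to \infty,$$ where (1) if $r = 2$, then $\{Z_i : i \geq 1\}$ is a collection of independent Poisson random variables with $Z_1 \sim \text{Poisson}(1)$ and $Z_i \sim \text{Poisson}(1/(2i))$ for all $i \geq 2$; (2) if $r \geq 3$, then $Z_i \equiv 0$ for all $i \geq 1$.
   Context: For integers $n \geq 1$, $r \geq 0$, let $[n] = \{1,\ldots,n\}$ and let $\mathcal{M}(n,r)$ be the (finite) set of $n \times n$ matrices $A = (a_{ij})$ with non-negative integer entries all of whose row sums and column sums equal $r$ (magical squares). Each $A \in \mathcal{M}(n,r)$ is identified with the labelled $r$-regular bipartite multigraph $G_A$ on vertices $\{R_1,\ldots,R_n\} \cup \{C_1,\ldots,C_n\}$ having exactly $a_{ij}$ edges between $R_i$ and $C_j$. A $k$-component of $A$ is a pair $(S,T)$ of non-empty subsets of $[n]$ with $|S| = |T| = k$ such that the submatrix $A(S,T) = (a_{ij})_{i\in S, j \in T}$ has all row and column sums equal to $r$. A component is irreducible if no other component $(S',T') \neq (S,T)$ satisfies $S' \subseteq S$, $T' \subseteq T$. Irreducible $k$-components of $A$ correspond to connected components of $G_A$ with $2k$ vertices. $\chi_k(A)$ denotes the number of irreducible $k$-components of $A$, equivalently the number of connected components of $G_A$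 having exactly $2k$ vertices; $\chi_k(A) = 0$ for $k > n$. Convergence in distribution of sequences is with respect to the product topology on $\mathbb{R}^{\mathbb{N}}$, i.e. convergence in distribution of $(\chi_1,\ldots,\chi_k)$ for each fixed $k$. *)

theory Defs
  imports "HOL-Probability.Probability" "Jordan_Normal_Form.Matrix"
begin

text \<open>
  Matrices are indexed from 0, so the index set \<open>[n]\<close> is rendered as \<open>{..<n}\<close>.
\<close>

definition magical_squares :: "nat \<Rightarrow> nat \<Rightarrow> nat mat set" where
  "magical_squares n r =
     {A \<in> carrier_mat n n.
        (\<forall>i<n. (\<Sum>j<n. A $$ (i, j)) = r) \<and> (\<forall>j<n. (\<Sum>i<n. A $$ (i, j)) = r)}"

lemma finite_magical_squares: "finite (magical_squares n r)"
proof (rule finite_subset)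
  let ?F = "({..<n} \<times> {..<n}) \<rightarrow>\<^sub>E {..r}"
  show "finite ((\<lambda>f. mat n n f) ` ?F)"
    by (intro finite_imageI finite_PiE) auto
  show "magical_squares n r \<subseteq> (\<lambda>f. mat n n f) ` ?F"
  proof
    fix A assume A: "A \<in> magical_squares n r"
    let ?f = "restrict (\<lambda>ij. A $$ ij) ({..<n} \<times> {..<n})"
    have "A $$ (i, j) \<le> r" if "i < n" "j < n" for i j
    proof -
      have "A $$ (i, j) \<le> (\<Sum>j<n. A $$ (i, j))"
        using that by (intro member_le_sum) auto
      then show ?thesis using A that by (auto simp: magical_squares_def)
    qed
    then have "?f \<in> ?F" by auto
    moreover have "A = mat n n ?f"
      using A by (intro eq_matI) (auto simp: magical_squares_def)
    ultimately show "A \<in> (\<lambda>f. mat n n f) ` ?F" by blast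
  qed
qed

lemma magical_squares_nonempty: "magical_squares n r \<noteq> {}"
proof -
  have "mat n n (\<lambda>(i, j). if i = j then r else 0) \<in> magical_squares n r"
    by (auto simp: magical_squares_def)
  then show ?thesis by blast
qed

text \<open>The common row and column sum \<open>r\<close> of the ambient square \<open>A\<close> is passed explicitly.\<close>

definition is_component :: "nat \<Rightarrow> nat mat \<Rightarrow> nat set \<times> nat set \<Rightarrow> bool" where
  "is_component r A = (\<lambda>(S, T).
     S \<noteq> {} \<and> T \<noteq> {} \<and> S \<subseteq> {..<dim_row A} \<and> T \<subseteq> {..<dim_col A} \<and> card S = card T \<and>
     (\<forall>i\<in>S. (\<Sum>j\<in>T. A $$ (i, j)) = r) \<and> (\<forall>j\<in>T. (\<Sum>i\<in>S. A $$ (i, j)) = r))"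

definition irreducible_component :: "nat \<Rightarrow> nat mat \<Rightarrow> nat set \<times> nat set \<Rightarrow> bool" where
  "irreducible_component r A = (\<lambda>(S, T).
     is_component r A (S, T) \<and>
     \<not> (\<exists>S' T'. is_component r A (S', T') \<and> (S', T') \<noteq> (S, T) \<and> S' \<subseteq> S \<and> T' \<subseteq> T))"

definition chi :: "nat \<Rightarrow> nat \<Rightarrow> nat mat \<Rightarrow> nat" where
  "chi r k A = card {(S, T). irreducible_component r A (S, T) \<and> card S = k}"

text \<open>
  The library has weak convergence only for measures on the reals. For \<open>'a = nat \<Rightarrow> real\<close>,
  the topology of the type \<^typ>\<open>'a\<close> is the product topology and \<^const>\<open>borel\<close> is the product
  sigma-algebra.
\<close>

definition weakly_converges ::
    "(nat \<Rightarrow> 'a::topological_space measure) \<Rightarrow> 'a measure \<Rightarrow> bool" where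
  "weakly_converges \<mu> \<nu> \<longleftrightarrow>
     (\<forall>f :: 'a \<Rightarrow> real. continuous_on UNIV f \<longrightarrow> bounded (range f) \<longrightarrow>
        (\<lambda>n. \<integral>x. f x \<partial>\<mu> n) \<longlonglongrightarrow> (\<integral>x. f x \<partial>\<nu>))"

definition converges_in_distribution ::
    "(nat \<Rightarrow> 'a measure) \<Rightarrow> (nat \<Rightarrow> 'a \<Rightarrow> 'c::topological_space) \<Rightarrow>
     'b measure \<Rightarrow> ('b \<Rightarrow> 'c) \<Rightarrow> bool" where
  "converges_in_distribution M X N Z \<longleftrightarrow>
     weakly_converges (\<lambda>n. distr (M n) borel (X n)) (distr N borel Z)"

end

theory Submission
  imports Defs "HOL-Real_Asymp.Real_Asymp"
begin

text \<open>
  Write \<open>h\<^sub>n\<close> for the number of magical squares of size \<open>n\<close> divided by \<open>(n!)\<^sup>2\<close>, and \<open>\<lambda>\<^sub>k\<close> for the number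
  of irreducible ones of size \<open>k\<close> divided by \<open>(k!)\<^sup>2\<close>. A magical square is a disjoint union of
  irreducible ones, so the exponential formula \<open>H = exp (\<Sum> \<lambda>\<^sub>k X\<^sup>k)\<close> holds for \<open>H = \<Sum> h\<^sub>n X\<^sup>n\<close>. Counting by
  components of size at most \<open>m\<close> gives an exact law: the probability that \<open>\<chi>\<^sub>k = c\<^sub>k\<close> for all \<open>k \<le> m\<close> is
  \<open>\<Prod> \<lambda>\<^sub>k\<^sup>c / c\<^sub>k!\<close> (with \<open>c = c\<^sub>k\<close> in the exponent) times \<open>g\<^sub>n\<^sub>-\<^sub>s / h\<^sub>n\<close>. Here \<open>s = \<Sum> k c\<^sub>k\<close> is the number of
  rows in these components, and \<open>g\<close> denotes the coefficients of \<open>H \<Prod> exp (- \<lambda>\<^sub>k X\<^sup>k)\<close>, the product being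
  over \<open>k \<le> m\<close> (lemma \<open>card_squares_profile\<close>). The proof is by induction on \<open>n\<close>, removing the component of a
  fixed row (lemma \<open>squares_recursion\<close>).

  Suppose that \<open>h\<^sub>n / h\<^sub>n\<^sub>+\<^sub>1\<close> tends to \<open>\<rho>\<close>. Since \<open>exp (- \<lambda>\<^sub>k X\<^sup>k)\<close> is entire, Tannery's theorem yields
  \<open>g\<^sub>n / h\<^sub>n \<longlonglongrightarrow> \<Prod> exp (- \<lambda>\<^sub>k \<rho>\<^sup>k)\<close>, so that the counts converge jointly to independent Poisson variables
  with parameters \<open>\<lambda>\<^sub>k \<rho>\<^sup>k\<close> (lemma \<open>profile_density_limit\<close>). Only \<open>\<rho>\<close> and, when \<open>\<rho>\<close> is non-zero, the \<open>\<lambda>\<^sub>k\<close>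
  remain to be found.

  For \<open>r \<ge> 3\<close> a square can be extended by a row and a column in about \<open>n\<^sup>r\<close> essentially different
  ways, whereas \<open>h\<close> is normalized by only \<open>n\<^sup>2\<close>; hence \<open>\<rho> = 0\<close> and all parameters vanish
  (lemma \<open>square_density_ratio_ge_3\<close>).

  For \<open>r = 2\<close>, contracting a path of length three to an edge gives a three-term recursion for the number of
  squares (lemma \<open>squares_2_recursion\<close>). It shows \<open>\<rho> = 1\<close>, and through \<open>X H' = (\<Sum> k \<lambda>\<^sub>k X\<^sup>k) H\<close> it also
  determines \<open>\<lambda>\<^sub>1 = 1\<close> and \<open>\<lambda>\<^sub>k = 1 / (2 k)\<close> for \<open>k \<ge> 2\<close> (lemma \<open>irr_density_2\<close>).

  Finally, for the product topology on sequences, convergence of the probabilities of all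
  integer cylinders implies weak convergence when the limit is concentrated on integer sequences
  (lemma \<open>weakly_converges_if_cylinders\<close>).
\<close>

unbundle no vec_syntax
no_notation Matrix.vec_index (infixl "$" 100)
unbundle fps_syntax

section \<open>Weak convergence of integer sequences\<close>

definition cylinder :: "nat \<Rightarrow> (nat \<Rightarrow> real) \<Rightarrow> (nat \<Rightarrow> real) set" where
  "cylinder m x = {y. \<forall>i<m. y i = x i}"

lemma cylinder_borel: "cylinder m x \<in> sets borel"
proof -
  have "closed (\<Inter>i\<in>{..<m}. {y :: nat \<Rightarrow> real. y i = x i})"
    by (intro closed_INT ballI closed_Collect_eq continuous_on_product_coordinates continuous_on_const)
  moreover have "(\<Inter>i\<in>{..<m}. {y :: nat \<Rightarrow> real. y i = x i}) = cylinder m x"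
    by (auto simp: cylinder_def)
  ultimately show ?thesis by (metis borel_closed)
qed

text \<open>Basic open sets of the product topology restrict only finitely many coordinates.\<close>
lemma cylinder_nhd:
  assumes f: "continuous_on UNIV (f :: (nat \<Rightarrow> real) \<Rightarrow> real)" and e: "e > 0"
  obtains m where "\<And>y. y \<in> cylinder m x \<Longrightarrow> \<bar>f y - f x\<bar> < e"
proof -
  have "open (f -` ball (f x) e)" using f by (intro open_vimage) auto
  moreover have "x \<in> f -` ball (f x) e" using e by simp
  ultimately have "\<exists>X. x \<in> (\<Pi>\<^sub>E i\<in>UNIV. X i) \<and> (\<forall>i. open (X i)) \<and> finite {i. X i \<noteq> UNIV} \<and> (\<Pi>\<^sub>E i\<in>UNIV. X i) \<subseteq> f -` ball (f x) e"
    by (intro product_topology_open_contains_basis[of "\<lambda>_. euclidean" UNIV, simplified]) (auto simp: open_fun_def)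
  then obtain X where X: "x \<in> (\<Pi>\<^sub>E i\<in>UNIV. X i)" "finite {i. X i \<noteq> UNIV}" "(\<Pi>\<^sub>E i\<in>UNIV. X i) \<subseteq> f -` ball (f x) e"
    by blast
  obtain m where m: "\<And>i. X i \<noteq> UNIV \<Longrightarrow> i < m"
    using X(2) by (metis (mono_tags, lifting) finite_nat_set_iff_bounded mem_Collect_eq)
  have "\<bar>f y - f x\<bar> < e" if "y \<in> cylinder m x" for y
  proof -
    have "y i \<in> X i" for i
      using that m[of i] X(1) by (cases "X i = UNIV") (auto simp: cylinder_def PiE_def Pi_def)
    then have "y \<in> (\<Pi>\<^sub>E i\<in>UNIV. X i)" by auto
    then have "y \<in> f -` ball (f x) e" using X(3) by (rule subsetD[rotated])
    then show ?thesis by (auto simp: dist_real_def)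
  qed
  then show ?thesis by (rule that)
qed

text \<open>
  The witness for the lower bound is a step function: on each cylinder fixing the first \<open>m\<close>
  coordinates to naturals below \<open>K\<close>, take the infimum of \<open>f\<close>. It lies below \<open>f\<close> everywhere. As
  \<open>K \<longlonglongrightarrow> \<infinity>\<close> these functions tend almost everywhere to the infimum of \<open>f\<close> over the cylinder through
  the argument, because the coordinates are natural numbers, and as \<open>m \<longlonglongrightarrow> \<infinity>\<close> those infima tend to \<open>f\<close>
  by continuity. Dominated convergence, used once for each limit, makes the loss in the integral
  smaller than \<open>e\<close>.
\<close>
lemma cylinder_lower_bound:
  fixes f :: "(nat \<Rightarrow> real) \<Rightarrow> real"
  assumes \<nu>: "prob_space \<nu>" "sets \<nu> = sets borel"
    and nat: "AE x in \<nu>. \<forall>i. x i \<in> \<nat>"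
    and f: "continuous_on UNIV f" and f0: "\<And>x. 0 \<le> f x" and fB: "\<And>x. f x \<le> B" and e: "e > 0"
  obtains P :: "(nat \<Rightarrow> nat) set" and m and g :: "(nat \<Rightarrow> nat) \<Rightarrow> real"
  where "finite P"
    "\<And>x. (\<Sum>c\<in>P. g c * indicator (cylinder m (\<lambda>i. real (c i))) x) \<le> f x"
    "(\<Sum>c\<in>P. g c * measure \<nu> (cylinder m (\<lambda>i. real (c i)))) > (\<integral>x. f x \<partial>\<nu>) - e"
proof -
  interpret prob_space \<nu> by fact
  define P where "P m K = {..<m} \<rightarrow>\<^sub>E {..<K::nat}" for m K :: nat
  define I where "I m x = Inf (f ` cylinder m x)" for m x
  define h where "h m K x = (\<Sum>c\<in>P m K. I m (\<lambda>i. real (c i)) * indicator (cylinder m (\<lambda>i. real (c i))) x)" for m K x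
  have finP: "finite (P m K)" for m K by (auto simp: P_def intro: finite_PiE)
  have self: "x \<in> cylinder m x" for m x by (simp add: cylinder_def)
  have bdd: "bdd_below (f ` X)" for X using f0 by (intro bdd_belowI2[where m = 0]) auto
  have I_le: "I m x \<le> f y" if "y \<in> cylinder m x" for m x y
    unfolding I_def using that bdd by (intro cInf_lower) auto
  have I0: "0 \<le> I m x" for m x
    unfolding I_def using self[of x m] f0 by (intro cInf_greatest) auto
  have I_cong: "I m x = I m y" if "x \<in> cylinder m y" for m x y
  proof -
    have "cylinder m x = cylinder m y" using that by (auto simp: cylinder_def)
    then show ?thesis by (simp add: I_def)
  qed
  \<comment> \<open>the cylinders over \<open>P m K\<close> are disjoint, so at most one summand is non-zero\<close>
  have h_eq: "h m K x = (if \<exists>c\<in>P m K. x \<in> cylinder m (\<lambda>i. real (c i)) then I m x else 0)" for m K x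
  proof (cases "\<exists>c\<in>P m K. x \<in> cylinder m (\<lambda>i. real (c i))")
    case True
    then obtain c where c: "c \<in> P m K" "x \<in> cylinder m (\<lambda>i. real (c i))" by blast
    have uniq: "d = c" if d: "d \<in> P m K" "x \<in> cylinder m (\<lambda>i. real (d i))" for d
    proof (rule PiE_ext)
      show "d \<in> {..<m} \<rightarrow>\<^sub>E {..<K}" "c \<in> {..<m} \<rightarrow>\<^sub>E {..<K}" using c d by (auto simp: P_def)
      fix i assume "i \<in> {..<m}"
      then show "d i = c i" using c(2) d(2) by (auto simp: cylinder_def)
    qed
    have "h m K x = (\<Sum>d\<in>P m K. if d = c then I m (\<lambda>i. real (c i)) else 0)"
      unfolding h_def
    proof (intro sum.cong refl)
      fix d assume "d \<in> P m K"
      then show "I m (\<lambda>i. real (d i)) * indicator (cylinder m (\<lambda>i. real (d i))) x = (if d = c then I m (\<lambda>i. real (c i)) else 0)"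
        using uniq[of d] c(2) by (cases "d = c") (auto simp: indicator_def)
    qed
    also have "\<dots> = I m x" using c finP I_cong[OF c(2)] by simp
    finally show ?thesis using True by simp
  next
    case False
    then show ?thesis unfolding h_def by (auto intro!: sum.neutral)
  qed
  have h_le: "h m K x \<le> f x" and h0: "0 \<le> h m K x" for m K x
    using I_le[OF self] I0 f0 by (auto simp: h_eq)
  have h_meas [measurable]: "h m K \<in> borel_measurable \<nu>" for m K
    unfolding h_def using cylinder_borel \<nu>(2)
    by (intro borel_measurable_sum borel_measurable_times borel_measurable_const borel_measurable_indicator) auto
  define g where "g m x = lim (\<lambda>K. h m K x)" for m x
  have g_meas [measurable]: "g m \<in> borel_measurable \<nu>" for m
    unfolding g_def by (rule borel_measurable_lim_metric) (rule h_meas)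
  have hI: "(\<lambda>K. h m K x) \<longlonglongrightarrow> I m x" if x: "\<forall>i. x i \<in> \<nat>" for m x
  proof -
    from x have "\<forall>i. \<exists>k. x i = real k" by (auto simp: Nats_def)
    then obtain c where c: "\<And>i. x i = real (c i)" by metis
    obtain K0 where K0: "\<And>i. i < m \<Longrightarrow> c i < K0"
      using finite_nat_set_iff_bounded[of "c ` {..<m}"] by auto
    have "h m K x = I m x" if "K \<ge> K0" for K
    proof -
      have "restrict c {..<m} \<in> P m K" using K0 that by (fastforce simp: P_def)
      moreover have "x \<in> cylinder m (\<lambda>i. real (restrict c {..<m} i))" using c by (auto simp: cylinder_def)
      ultimately show ?thesis by (auto simp: h_eq)
    qed
    then have "eventually (\<lambda>K. h m K x = I m x) sequentially" by (auto simp: eventually_sequentially)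
    then show ?thesis by (rule tendsto_eventually)
  qed
  have gI: "g m x = I m x" if "\<forall>i. x i \<in> \<nat>" for m x
    unfolding g_def using hI[OF that] by (rule limI)
  have fmeas [measurable]: "f \<in> borel_measurable \<nu>"
    using borel_measurable_continuous_onI[OF f] \<nu>(2) by (simp cong: measurable_cong_sets)
  have h_lim: "(\<lambda>K. \<integral>x. h m K x \<partial>\<nu>) \<longlonglongrightarrow> (\<integral>x. g m x \<partial>\<nu>)" for m
  proof (rule integral_dominated_convergence[where w = "\<lambda>_. B"])
    show "AE x in \<nu>. (\<lambda>K. h m K x) \<longlonglongrightarrow> g m x" using nat by eventually_elim (use hI gI in auto)
    show "AE x in \<nu>. norm (h m K x) \<le> B" for K using h_le h0 fB
      by (intro AE_I2) (metis abs_of_nonneg order_trans real_norm_def)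
  qed auto
  have g_lim: "(\<lambda>m. \<integral>x. g m x \<partial>\<nu>) \<longlonglongrightarrow> (\<integral>x. f x \<partial>\<nu>)"
  proof (rule integral_dominated_convergence[where w = "\<lambda>_. B"])
    show "AE x in \<nu>. (\<lambda>m. g m x) \<longlonglongrightarrow> f x" using nat
    proof eventually_elim
      case (elim x)
      have "(\<lambda>m. I m x) \<longlonglongrightarrow> f x"
      proof (rule LIMSEQ_I)
        fix e :: real assume e: "e > 0"
        then obtain m0 where m0: "\<And>y. y \<in> cylinder m0 x \<Longrightarrow> \<bar>f y - f x\<bar> < e / 2"
          using cylinder_nhd[OF f, of "e / 2" x] by auto
        have "norm (I m x - f x) < e" if "m \<ge> m0" for m
        proof -
          have "f x - e / 2 \<le> f y" if "y \<in> cylinder m x" for y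
          proof -
            have "y \<in> cylinder m0 x" using that \<open>m \<ge> m0\<close> by (auto simp: cylinder_def)
            from m0[OF this] show ?thesis by linarith
          qed
          then have "f x - e / 2 \<le> I m x"
            unfolding I_def using self[of x m] by (intro cInf_greatest) auto
          then show ?thesis using I_le[OF self, of m x] e by auto
        qed
        then show "\<exists>m0. \<forall>m\<ge>m0. norm (I m x - f x) < e" by blast
      qed
      then show ?case using gI[OF elim] by simp
    qed
    show "AE x in \<nu>. norm (g m x) \<le> B" for m
      using nat
    proof eventually_elim
      case (elim x)
      then show ?case using gI[OF elim, of m] I0[of m x] I_le[OF self, of m x] fB[of x] by auto
    qed
  qed auto
  obtain m where m: "(\<integral>x. g m x \<partial>\<nu>) > (\<integral>x. f x \<partial>\<nu>) - e / 2"
    using order_tendstoD(1)[OF g_lim, of "(\<integral>x. f x \<partial>\<nu>) - e / 2"] e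
    by (auto simp: eventually_sequentially)
  obtain K where K: "(\<integral>x. h m K x \<partial>\<nu>) > (\<integral>x. g m x \<partial>\<nu>) - e / 2"
    using order_tendstoD(1)[OF h_lim[of m], of "(\<integral>x. g m x \<partial>\<nu>) - e / 2"] e
    by (auto simp: eventually_sequentially)
  have "(\<integral>x. h m K x \<partial>\<nu>) = (\<Sum>c\<in>P m K. I m (\<lambda>i. real (c i)) * measure \<nu> (cylinder m (\<lambda>i. real (c i))))"
    unfolding h_def using cylinder_borel \<nu>(2)
    by (subst Bochner_Integration.integral_sum) (auto simp: emeasure_eq_measure)
  then show ?thesis
    using that[of "P m K" "\<lambda>c. I m (\<lambda>i. real (c i))" m] finP m K h_le[unfolded h_def] by auto
qed

text \<open>
  Lower bounds suffice: if \<open>\<integral>f d\<nu> - e\<close> is eventually a lower bound of \<open>\<integral>f d\<mu>\<^sub>n\<close> for every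
  non-negative bounded continuous \<open>f\<close>, then applying this to \<open>f + B\<close> and to \<open>B - f\<close> gives
  convergence. The lower bound holds because below \<open>f\<close> there is a step function over finitely
  many cylinders that loses little under \<open>\<nu>\<close>, and its integrals are finite combinations of cylinder
  probabilities.
\<close>
theorem weakly_converges_if_cylinders:
  fixes \<mu> :: "nat \<Rightarrow> (nat \<Rightarrow> real) measure"
  assumes \<mu>: "\<And>n. prob_space (\<mu> n)" "\<And>n. sets (\<mu> n) = sets borel"
    and \<nu>: "prob_space \<nu>" "sets \<nu> = sets borel"
    and nat: "AE x in \<nu>. \<forall>i. x i \<in> \<nat>"
    and lim: "\<And>m c. (\<lambda>n. measure (\<mu> n) (cylinder m (\<lambda>i. real (c i)))) \<longlonglongrightarrow> measure \<nu> (cylinder m (\<lambda>i. real (c i)))"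
  shows "weakly_converges \<mu> \<nu>"
proof -
  have meas: "f \<in> borel_measurable (\<mu> n)" "f \<in> borel_measurable \<nu>"
    if "continuous_on UNIV f" for f :: "(nat \<Rightarrow> real) \<Rightarrow> real" and n
    using borel_measurable_continuous_onI[OF that] \<mu>(2) \<nu>(2) by (simp_all cong: measurable_cong_sets)
  have int: "integrable (\<mu> n) f" "integrable \<nu> f"
    if "continuous_on UNIV f" "\<And>x. \<bar>f x\<bar> \<le> B" for f :: "(nat \<Rightarrow> real) \<Rightarrow> real" and n B
    using meas[OF that(1)] that(2) \<mu>(1)[of n] \<nu>(1)
    by (auto intro!: finite_measure.integrable_const_bound[where B = B] simp: prob_space_def)
  have lower: "\<forall>\<^sub>F n in sequentially. (\<integral>x. f x \<partial>\<mu> n) > (\<integral>x. f x \<partial>\<nu>) - e"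
    if f: "continuous_on UNIV f" and f0: "\<And>x. 0 \<le> f x" and fB: "\<And>x. f x \<le> B" and e: "e > 0"
    for f :: "(nat \<Rightarrow> real) \<Rightarrow> real" and B e
  proof -
    obtain P g m where P: "finite P"
      "\<And>x. (\<Sum>c\<in>P. g c * indicator (cylinder m (\<lambda>i. real (c i))) x) \<le> f x"
      "(\<Sum>c\<in>P. g c * measure \<nu> (cylinder m (\<lambda>i. real (c i)))) > (\<integral>x. f x \<partial>\<nu>) - e"
      by (rule cylinder_lower_bound[OF \<nu> nat f f0 fB e]) (rule that)
    have "(\<Sum>c\<in>P. g c * measure (\<mu> n) (cylinder m (\<lambda>i. real (c i)))) \<le> (\<integral>x. f x \<partial>\<mu> n)" for n
    proof -
      interpret prob_space "\<mu> n" by fact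
      have I: "integrable (\<mu> n) (\<lambda>x. g c * indicator (cylinder m (\<lambda>i. real (c i))) x)" for c
        using cylinder_borel \<mu>(2) by (auto simp: emeasure_eq_measure)
      have "(\<Sum>c\<in>P. g c * measure (\<mu> n) (cylinder m (\<lambda>i. real (c i))))
        = (\<integral>x. (\<Sum>c\<in>P. g c * indicator (cylinder m (\<lambda>i. real (c i))) x) \<partial>\<mu> n)"
        using cylinder_borel \<mu>(2) by (subst Bochner_Integration.integral_sum) (auto simp: emeasure_eq_measure)
      also have "\<dots> \<le> (\<integral>x. f x \<partial>\<mu> n)"
        using P(2) f0 fB I by (intro integral_mono Bochner_Integration.integrable_sum int[OF f, of B]) auto
      finally show ?thesis .
    qed
    moreover have "(\<lambda>n. \<Sum>c\<in>P. g c * measure (\<mu> n) (cylinder m (\<lambda>i. real (c i)))) \<longlonglongrightarrow>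
        (\<Sum>c\<in>P. g c * measure \<nu> (cylinder m (\<lambda>i. real (c i))))"
      by (intro tendsto_sum tendsto_mult tendsto_const lim)
    ultimately show ?thesis
      by (blast intro: eventually_mono[OF order_tendstoD(1)[OF _ P(3)]] less_le_trans)
  qed
  have "(\<lambda>n. \<integral>x. f x \<partial>\<mu> n) \<longlonglongrightarrow> (\<integral>x. f x \<partial>\<nu>)"
    if f: "continuous_on UNIV f" and b: "bounded (range f)" for f :: "(nat \<Rightarrow> real) \<Rightarrow> real"
  proof -
    obtain B where B: "\<And>x. \<bar>f x\<bar> \<le> B" using b by (auto simp: bounded_iff)
    have B': "0 \<le> f x + B" "f x + B \<le> 2 * B" "0 \<le> B - f x" "B - f x \<le> 2 * B" for x using B[of x] by auto
    have p: "(\<integral>x. f x + B \<partial>\<mu> n) = (\<integral>x. f x \<partial>\<mu> n) + B" "(\<integral>x. B - f x \<partial>\<mu> n) = B - (\<integral>x. f x \<partial>\<mu> n)" for n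
      using int(1)[OF f B, of n] \<mu>(1)[of n] by (auto simp: prob_space.prob_space finite_measure.integrable_const prob_space_def)
    have q: "(\<integral>x. f x + B \<partial>\<nu>) = (\<integral>x. f x \<partial>\<nu>) + B" "(\<integral>x. B - f x \<partial>\<nu>) = B - (\<integral>x. f x \<partial>\<nu>)"
      using int(2)[OF f B] \<nu>(1) by (auto simp: prob_space.prob_space finite_measure.integrable_const prob_space_def)
    show ?thesis
    proof (rule tendstoI)
      fix e :: real assume e: "e > 0"
      have "\<forall>\<^sub>F n in sequentially. (\<integral>x. f x + B \<partial>\<mu> n) > (\<integral>x. f x + B \<partial>\<nu>) - e"
        by (intro lower[where B = "2 * B"] continuous_intros f B' e)
      moreover have "\<forall>\<^sub>F n in sequentially. (\<integral>x. B - f x \<partial>\<mu> n) > (\<integral>x. B - f x \<partial>\<nu>) - e"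
        by (intro lower[where B = "2 * B"] continuous_intros f B' e)
      ultimately show "\<forall>\<^sub>F n in sequentially. dist (\<integral>x. f x \<partial>\<mu> n) (\<integral>x. f x \<partial>\<nu>) < e"
        by eventually_elim (auto simp: p q dist_real_def)
    qed
  qed
  then show ?thesis by (auto simp: weakly_converges_def)
qed

section \<open>Squares and their components\<close>

text \<open>
  A square is a function supported on \<open>S \<times> T\<close>. This makes it possible to cut along a component and
  keep the original labels, so that the pieces need no reindexing; the value zero off
  \<open>S \<times> T\<close> makes the function determined by its entries.
\<close>
definition squares :: "nat \<Rightarrow> 'a set \<Rightarrow> 'b set \<Rightarrow> ('a \<Rightarrow> 'b \<Rightarrow> nat) set" where
  "squares r S T = {a. (\<forall>i j. a i j \<noteq> 0 \<longrightarrow> i \<in> S \<and> j \<in> T) \<and>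
     (\<forall>i\<in>S. (\<Sum>j\<in>T. a i j) = r) \<and> (\<forall>j\<in>T. (\<Sum>i\<in>S. a i j) = r)}"

text \<open>
  No edge of the bipartite multigraph leaves \<open>U \<union> V\<close>: the pair is a union of connected
  components (possibly empty).
\<close>
definition closed_pair :: "('a \<Rightarrow> 'b \<Rightarrow> nat) \<Rightarrow> 'a set \<Rightarrow> 'b set \<Rightarrow> bool" where
  "closed_pair a U V \<longleftrightarrow> (\<forall>i j. a i j \<noteq> 0 \<longrightarrow> (i \<in> U \<longleftrightarrow> j \<in> V))"

definition comps :: "'a set \<Rightarrow> 'b set \<Rightarrow> ('a \<Rightarrow> 'b \<Rightarrow> nat) \<Rightarrow> ('a set \<times> 'b set) set" where
  "comps S T a = {(U, V). U \<subseteq> S \<and> V \<subseteq> T \<and> U \<noteq> {} \<and> closed_pair a U V \<and>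
     (\<forall>U' V'. U' \<subseteq> U \<longrightarrow> V' \<subseteq> V \<longrightarrow> U' \<noteq> {} \<longrightarrow> closed_pair a U' V' \<longrightarrow> U' = U \<and> V' = V)}"

definition irr_squares :: "nat \<Rightarrow> 'a set \<Rightarrow> 'b set \<Rightarrow> ('a \<Rightarrow> 'b \<Rightarrow> nat) set" where
  "irr_squares r S T = {a \<in> squares r S T. (S, T) \<in> comps S T a}"

definition ncomps :: "'a set \<Rightarrow> 'b set \<Rightarrow> ('a \<Rightarrow> 'b \<Rightarrow> nat) \<Rightarrow> nat \<Rightarrow> nat" where
  "ncomps S T a k = card {p \<in> comps S T a. card (fst p) = k}"

lemma squaresI:
  assumes "\<And>i j. a i j \<noteq> 0 \<Longrightarrow> i \<in> S \<and> j \<in> T"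
    and "\<And>i. i \<in> S \<Longrightarrow> (\<Sum>j\<in>T. a i j) = r" and "\<And>j. j \<in> T \<Longrightarrow> (\<Sum>i\<in>S. a i j) = r"
  shows "a \<in> squares r S T"
  using assms by (auto simp: squares_def)

lemma squaresD:
  assumes "a \<in> squares r S T"
  shows "a i j \<noteq> 0 \<Longrightarrow> i \<in> S" "a i j \<noteq> 0 \<Longrightarrow> j \<in> T"
    and "i \<in> S \<Longrightarrow> (\<Sum>j\<in>T. a i j) = r" "j \<in> T \<Longrightarrow> (\<Sum>i\<in>S. a i j) = r"
  using assms by (auto simp: squares_def)

lemma squares_outside:
  assumes "a \<in> squares r S T" "i \<notin> S \<or> j \<notin> T"
  shows "a i j = 0"
  using squaresD(1,2)[OF assms(1)] assms(2) by blast

lemma squares_entry_le: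
  assumes "a \<in> squares r S T" "finite T"
  shows "a i j \<le> r"
proof (cases "i \<in> S \<and> j \<in> T")
  case True
  then have "a i j \<le> (\<Sum>j\<in>T. a i j)"
    using assms by (intro member_le_sum) auto
  then show ?thesis using squaresD(3)[OF assms(1)] True by auto
next
  case False
  then show ?thesis using squares_outside[OF assms(1)] by force
qed

lemma finite_squares:
  assumes "finite S" "finite T"
  shows "finite (squares r S T)"
proof (rule finite_subset)
  let ?F = "(S \<times> T) \<rightarrow>\<^sub>E {..r}"
  show "finite ((\<lambda>f i j. if i \<in> S \<and> j \<in> T then f (i, j) else 0) ` ?F)"
    using assms by (intro finite_imageI finite_PiE) auto
  show "squares r S T \<subseteq> (\<lambda>f i j. if i \<in> S \<and> j \<in> T then f (i, j) else 0) ` ?F"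
  proof
    fix a assume a: "a \<in> squares r S T"
    then have "restrict (\<lambda>(i, j). a i j) (S \<times> T) \<in> ?F"
      using squares_entry_le[OF a assms(2)] by auto
    moreover have "a = (\<lambda>i j. if i \<in> S \<and> j \<in> T then restrict (\<lambda>(i, j). a i j) (S \<times> T) (i, j) else 0)"
      using squares_outside[OF a] by (auto intro!: ext)
    ultimately show "a \<in> (\<lambda>f i j. if i \<in> S \<and> j \<in> T then f (i, j) else 0) ` ?F" by blast
  qed
qed

lemma squares_row_entry:
  assumes "a \<in> squares r S T" "r > 0" "i \<in> S"
  obtains j where "j \<in> T" "a i j \<noteq> 0"
  using squaresD(3)[OF assms(1,3)] assms(2) by (metis sum.neutral less_numeral_extra(3))

lemma squares_col_entry:
  assumes "a \<in> squares r S T" "r > 0" "j \<in> T"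
  obtains i where "i \<in> S" "a i j \<noteq> 0"
  using squaresD(4)[OF assms(1,3)] assms(2) by (metis sum.neutral less_numeral_extra(3))

text \<open>
  Both sides count the total of all entries, which is \<open>r * card S\<close> by rows and \<open>r * card T\<close> by
  columns. This is why the equality of cardinalities demanded of a component is automatic.
\<close>
lemma squares_card_eq:
  assumes "a \<in> squares r S T" "r > 0"
  shows "card S = card T"
proof -
  have "r * card S = (\<Sum>i\<in>S. \<Sum>j\<in>T. a i j)" using squaresD(3)[OF assms(1)] by simp
  also have "\<dots> = (\<Sum>j\<in>T. \<Sum>i\<in>S. a i j)" by (rule sum.swap)
  also have "\<dots> = r * card T" using squaresD(4)[OF assms(1)] by simp
  finally show ?thesis using assms(2) by simp
qed

lemma squares_add:
  assumes "b \<in> squares r U V" "c \<in> squares r (S - U) (T - V)" "U \<subseteq> S" "V \<subseteq> T" "finite S" "finite T"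
  shows "(\<lambda>i j. b i j + c i j) \<in> squares r S T"
proof (rule squaresI)
  fix i j assume "b i j + c i j \<noteq> 0"
  then show "i \<in> S \<and> j \<in> T"
    using squaresD(1,2)[OF assms(1), of i j] squaresD(1,2)[OF assms(2), of i j] assms(3,4)
    by (cases "b i j = 0") auto
next
  fix i assume i: "i \<in> S"
  have "(\<Sum>j\<in>T. b i j) = (\<Sum>j\<in>V. b i j)"
    using squares_outside[OF assms(1)] assms by (intro sum.mono_neutral_right) auto
  moreover have "(\<Sum>j\<in>T. c i j) = (\<Sum>j\<in>T-V. c i j)"
    using squares_outside[OF assms(2)] assms by (intro sum.mono_neutral_right) auto
  ultimately show "(\<Sum>j\<in>T. b i j + c i j) = r"
    using squaresD(3)[OF assms(1), of i] squaresD(3)[OF assms(2), of i] i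
      squares_outside[OF assms(1), of i] squares_outside[OF assms(2), of i]
    by (cases "i \<in> U") (auto simp: sum.distrib)
next
  fix j assume j: "j \<in> T"
  have "(\<Sum>i\<in>S. b i j) = (\<Sum>i\<in>U. b i j)"
    using squares_outside[OF assms(1)] assms by (intro sum.mono_neutral_right) auto
  moreover have "(\<Sum>i\<in>S. c i j) = (\<Sum>i\<in>S-U. c i j)"
    using squares_outside[OF assms(2)] assms by (intro sum.mono_neutral_right) auto
  ultimately show "(\<Sum>i\<in>S. b i j + c i j) = r"
    using squaresD(4)[OF assms(1), of j] squaresD(4)[OF assms(2), of j] j
      squares_outside[OF assms(1), of _ j] squares_outside[OF assms(2), of _ j]
    by (cases "j \<in> V") (auto simp: sum.distrib)
qed

lemma squares_restrict:
  assumes a: "a \<in> squares r S T" and c: "closed_pair a U V" and "U \<subseteq> S" "V \<subseteq> T" "finite S" "finite T"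
  shows "(\<lambda>i j. if i \<in> U then a i j else 0) \<in> squares r U V"
proof (rule squaresI)
  fix i j assume "(if i \<in> U then a i j else 0) \<noteq> 0"
  then show "i \<in> U \<and> j \<in> V" using c by (auto simp: closed_pair_def split: if_splits)
next
  fix i assume i: "i \<in> U"
  have "(\<Sum>j\<in>T. a i j) = (\<Sum>j\<in>V. a i j)"
    using c assms i by (intro sum.mono_neutral_right) (auto simp: closed_pair_def)
  then show "(\<Sum>j\<in>V. if i \<in> U then a i j else 0) = r" using i squaresD(3)[OF a, of i] assms by auto
next
  fix j assume j: "j \<in> V"
  have "(\<Sum>i\<in>S. a i j) = (\<Sum>i\<in>U. a i j)"
    using c assms j by (intro sum.mono_neutral_right) (auto simp: closed_pair_def)
  then show "(\<Sum>i\<in>U. if i \<in> U then a i j else 0) = r" using j squaresD(4)[OF a, of j] assms by auto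
qed

lemma closed_pair_Diff:
  assumes "a \<in> squares r S T" "closed_pair a U V" "closed_pair a U' V'"
  shows "closed_pair a (U - U') (V - V')" "closed_pair a (S - U) (T - V)" "closed_pair a (U \<inter> U') (V \<inter> V')"
  using assms(2,3) squaresD(1,2)[OF assms(1)] unfolding closed_pair_def by blast+

text \<open>
  Closed pairs are stable under intersection, so two minimal ones that share a row coincide.
\<close>
lemma comps_disjoint:
  assumes "a \<in> squares r S T" "p \<in> comps S T a" "q \<in> comps S T a" "fst p \<inter> fst q \<noteq> {}"
  shows "p = q"
proof -
  obtain U V U' V' where pq: "p = (U, V)" "q = (U', V')" by (metis surj_pair)
  have "closed_pair a (U \<inter> U') (V \<inter> V')"
    using assms(2,3) pq by (intro closed_pair_Diff(3)[OF assms(1)]) (auto simp: comps_def)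
  moreover have "U \<inter> U' \<noteq> {}" using assms(4) pq by simp
  ultimately have "U \<inter> U' = U \<and> V \<inter> V' = V" "U \<inter> U' = U' \<and> V \<inter> V' = V'"
    using assms(2,3) pq unfolding comps_def by (simp_all, (metis inf_le1 inf_le2)+)
  then show ?thesis using pq by auto
qed

text \<open>
  A closed pair containing \<open>i\<close> of least total size is minimal among all closed pairs: a smaller
  one that avoids \<open>i\<close> could be removed from it, leaving a closed pair containing \<open>i\<close> of smaller size.
\<close>
lemma comps_cover:
  assumes a: "a \<in> squares r S T" and fin: "finite S" "finite T" and i: "i \<in> S"
  obtains U V where "(U, V) \<in> comps S T a" "i \<in> U"
proof -
  define P where "P = (\<lambda>(U, V). U \<subseteq> S \<and> V \<subseteq> T \<and> i \<in> U \<and> closed_pair a U V)"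
  have "P (S, T)" using squaresD(1,2)[OF a] i by (auto simp: P_def closed_pair_def)
  from ex_has_least_nat[of P, OF this, of "\<lambda>(U, V). card U + card V"] obtain p where
    "P p" "\<And>q. P q \<Longrightarrow> (\<lambda>(U, V). card U + card V) p \<le> (\<lambda>(U, V). card U + card V) q" by blast
  moreover obtain U V where p: "p = (U, V)" by (metis surj_pair)
  ultimately have UV: "P (U, V)" and
    least: "\<And>U' V'. P (U', V') \<Longrightarrow> card U + card V \<le> card U' + card V'" by auto
  have finUV: "finite U" "finite V" using UV fin by (auto simp: P_def intro: finite_subset)
  have "U' = U \<and> V' = V" if *: "U' \<subseteq> U" "V' \<subseteq> V" "U' \<noteq> {}" "closed_pair a U' V'" for U' V'
  proof (cases "i \<in> U'")
    case True
    then have "card U + card V \<le> card U' + card V'" using UV * by (intro least) (auto simp: P_def)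
    moreover have "card U' \<le> card U" "card V' \<le> card V" using * finUV by (auto intro: card_mono)
    ultimately show ?thesis using * finUV by (metis add_le_cancel_left add_le_cancel_right card_seteq dual_order.trans nat_add_left_cancel_le add_le_mono le_antisym)
  next
    case False
    have "P (U - U', V - V')"
      using UV * False closed_pair_Diff(1)[OF a, of U V U' V'] by (auto simp: P_def)
    then have "card U + card V \<le> card (U - U') + card (V - V')" by (rule least)
    moreover have "card (U - U') < card U" using * finUV by (intro psubset_card_mono) auto
    moreover have "card (V - V') \<le> card V" using * finUV by (intro card_mono) auto
    ultimately show ?thesis by linarith
  qed
  then have "(U, V) \<in> comps S T a" using UV by (auto simp: comps_def P_def)
  then show ?thesis using that UV by (auto simp: P_def)
qed

lemma comps_restrict_irr:
  assumes a: "a \<in> squares r S T" and fin: "finite S" "finite T" and UV: "(U, V) \<in> comps S T a"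
  shows "(\<lambda>i j. if i \<in> U then a i j else 0) \<in> irr_squares r U V" (is "?b \<in> _")
proof -
  have c: "closed_pair a U V" "U \<subseteq> S" "V \<subseteq> T" "U \<noteq> {}"
    and least: "\<And>U' V'. U' \<subseteq> U \<Longrightarrow> V' \<subseteq> V \<Longrightarrow> U' \<noteq> {} \<Longrightarrow> closed_pair a U' V' \<Longrightarrow> U' = U \<and> V' = V"
    using UV by (auto simp: comps_def)
  have 1: "?b \<in> squares r U V" using squares_restrict[OF a c(1-3) fin] .
  have 2: "closed_pair ?b U V" using c(1) by (auto simp: closed_pair_def)
  have 3: "closed_pair a U' V'" if "U' \<subseteq> U" "V' \<subseteq> V" "closed_pair ?b U' V'" for U' V'
    unfolding closed_pair_def
  proof (intro allI impI)
    fix i j assume ij: "a i j \<noteq> 0"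
    then have "i \<in> U \<longleftrightarrow> j \<in> V" using c(1) by (auto simp: closed_pair_def)
    then show "i \<in> U' \<longleftrightarrow> j \<in> V'"
      using ij that by (cases "i \<in> U") (auto simp: closed_pair_def)
  qed
  have "(U, V) \<in> comps U V ?b"
    using least 2 3 c(4) unfolding comps_def by blast
  then show ?thesis using 1 by (auto simp: irr_squares_def)
qed

text \<open>
  A closed pair of \<open>b + c\<close> is one that is closed for \<open>b\<close> and for \<open>c\<close>, and the two summands live on
  disjoint sets of rows and columns. The hypothesis \<open>r > 0\<close> enters because a column shared with \<open>V\<close>
  must carry an edge in order to force a shared row.
\<close>
lemma comps_add:
  assumes b: "b \<in> irr_squares r U V" and c: "c \<in> squares r (S - U) (T - V)"
    and UV: "U \<subseteq> S" "V \<subseteq> T" and fin: "finite S" "finite T" and r: "r > 0"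
  shows "comps S T (\<lambda>i j. b i j + c i j) = insert (U, V) (comps (S - U) (T - V) c)" (is "comps S T ?a = _")
proof -
  have b1: "b \<in> squares r U V" and b2: "(U, V) \<in> comps U V b" using b by (auto simp: irr_squares_def)
  have a: "?a \<in> squares r S T" using squares_add[OF b1 c UV fin] .
  have cl: "closed_pair ?a U' V' \<longleftrightarrow> closed_pair b U' V' \<and> closed_pair c U' V'" for U' V'
    by (auto simp: closed_pair_def)
  have clb: "closed_pair b U' V'" if "U' \<inter> U = {}" "V' \<inter> V = {}" for U' V'
    using that squaresD(1,2)[OF b1] by (auto simp: closed_pair_def)
  have clc: "closed_pair c U V" using squaresD(1,2)[OF c] by (auto simp: closed_pair_def)
  have 1: "(U, V) \<in> comps S T ?a"
    using b2 UV clc unfolding comps_def cl by auto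
  have 2: "(U', V') \<in> comps S T ?a" if "(U', V') \<in> comps (S - U) (T - V) c" for U' V'
  proof -
    have "U' \<inter> U = {}" "V' \<inter> V = {}" using that by (auto simp: comps_def)
    then show ?thesis using that clb unfolding comps_def cl by auto
  qed
  have 3: "(U', V') \<in> comps (S - U) (T - V) c" if p: "(U', V') \<in> comps S T ?a" "(U', V') \<noteq> (U, V)" for U' V'
  proof -
    have U: "U' \<inter> U = {}" using comps_disjoint[OF a p(1) 1] p(2) by auto
    have V: "V' \<inter> V = {}"
    proof (rule ccontr)
      assume "V' \<inter> V \<noteq> {}"
      then obtain j where j: "j \<in> V'" "j \<in> V" by auto
      then obtain i where "?a i j \<noteq> 0" using squares_col_entry[OF a r, of j] UV by blast
      moreover have "closed_pair ?a U V" "closed_pair ?a U' V'" using 1 p by (auto simp: comps_def)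
      ultimately have "i \<in> U" "i \<in> U'" using j unfolding closed_pair_def by blast+
      then show False using U by auto
    qed
    have "U'' = U' \<and> V'' = V'" if *: "U'' \<subseteq> U'" "V'' \<subseteq> V'" "U'' \<noteq> {}" "closed_pair c U'' V''" for U'' V''
    proof -
      have "closed_pair b U'' V''" using * U V by (intro clb) auto
      then have "closed_pair ?a U'' V''" using * cl by auto
      then show ?thesis using p(1) * by (auto simp: comps_def)
    qed
    moreover have "closed_pair c U' V'" "U' \<subseteq> S" "V' \<subseteq> T" "U' \<noteq> {}" using p(1) cl by (auto simp: comps_def)
    ultimately show ?thesis using U V by (auto simp: comps_def)
  qed
  show ?thesis using 1 2 3 by auto
qed

lemma finite_comps: "finite S \<Longrightarrow> finite T \<Longrightarrow> finite (comps S T a)"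
  by (rule finite_subset[of _ "Pow S \<times> Pow T"]) (auto simp: comps_def)

lemma ncomps_add:
  assumes b: "b \<in> irr_squares r U V" and c: "c \<in> squares r (S - U) (T - V)"
    and UV: "U \<subseteq> S" "V \<subseteq> T" and fin: "finite S" "finite T" and r: "r > 0"
  shows "ncomps S T (\<lambda>i j. b i j + c i j) k = ncomps (S - U) (T - V) c k + (if k = card U then 1 else 0)"
proof -
  have "U \<noteq> {}" using b by (auto simp: irr_squares_def comps_def)
  then have 1: "(U, V) \<notin> comps (S - U) (T - V) c" by (auto simp: comps_def)
  have 2: "finite (comps (S - U) (T - V) c)" using fin by (intro finite_comps) auto
  have "{p \<in> comps S T (\<lambda>i j. b i j + c i j). card (fst p) = k} =
     (if k = card U then insert (U, V) {p \<in> comps (S - U) (T - V) c. card (fst p) = k}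
      else {p \<in> comps (S - U) (T - V) c. card (fst p) = k})"
    unfolding comps_add[OF assms] by auto
  then show ?thesis using 1 2 by (auto simp: ncomps_def)
qed

text \<open>
  Every square is cut in a unique way along the component of a fixed row \<open>i0\<close>; rooting at \<open>i0\<close>
  avoids counting a square once per component.
\<close>
lemma sum_squares_decompose:
  fixes F :: "('a \<Rightarrow> 'b \<Rightarrow> nat) \<Rightarrow> 'c::comm_monoid_add"
  assumes fin: "finite S" "finite T" and i0: "i0 \<in> S" and r: "r > 0"
  shows "(\<Sum>a\<in>squares r S T. F a) =
    (\<Sum>(U, V) \<in> {U. U \<subseteq> S \<and> i0 \<in> U} \<times> Pow T.
       \<Sum>b\<in>irr_squares r U V. \<Sum>c\<in>squares r (S - U) (T - V). F (\<lambda>i j. b i j + c i j))"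
proof -
  let ?P = "{U. U \<subseteq> S \<and> i0 \<in> U} \<times> Pow T"
  let ?Q = "\<lambda>p. irr_squares r (fst p) (snd p) \<times> squares r (S - fst p) (T - snd p)"
  let ?f = "\<lambda>(p :: 'a set \<times> 'b set, b :: 'a \<Rightarrow> 'b \<Rightarrow> nat, c :: 'a \<Rightarrow> 'b \<Rightarrow> nat) i j. b i j + c i j"
  have finP: "finite ?P" using fin by auto
  have finI: "finite (irr_squares r U V)" if "U \<subseteq> S" "V \<subseteq> T" for U V
    using finite_squares[of U V r] that fin finite_subset
    by (auto simp: irr_squares_def intro: finite_subset)
  have finQ: "\<forall>p\<in>?P. finite (?Q p)"
    using fin finI by (auto intro!: finite_squares)
  have inj: "inj_on ?f (Sigma ?P ?Q)"
  proof (rule inj_onI)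
    fix x y assume x: "x \<in> Sigma ?P ?Q" and y: "y \<in> Sigma ?P ?Q" and eq: "?f x = ?f y"
    obtain U V b c where xd: "x = ((U, V), b, c)" by (metis surj_pair)
    obtain U' V' b' c' where yd: "y = ((U', V'), b', c')" by (metis surj_pair)
    have X: "U \<subseteq> S" "V \<subseteq> T" "i0 \<in> U" "b \<in> irr_squares r U V" "c \<in> squares r (S - U) (T - V)"
      using x xd by auto
    have Y: "U' \<subseteq> S" "V' \<subseteq> T" "i0 \<in> U'" "b' \<in> irr_squares r U' V'" "c' \<in> squares r (S - U') (T - V')"
      using y yd by auto
    have eq': "(\<lambda>i j. b i j + c i j) = (\<lambda>i j. b' i j + c' i j)" using eq xd yd by simp
    have "(U, V) \<in> comps S T (\<lambda>i j. b i j + c i j)" using comps_add[OF X(4,5,1,2) fin r] by simp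
    moreover have "(U', V') \<in> comps S T (\<lambda>i j. b i j + c i j)"
      unfolding eq' using comps_add[OF Y(4,5,1,2) fin r] by simp
    moreover have "(\<lambda>i j. b i j + c i j) \<in> squares r S T"
      using X fin by (intro squares_add[of b r U V]) (auto simp: irr_squares_def)
    ultimately have UV: "U' = U" "V' = V" using comps_disjoint X(3) Y(3) by fastforce+
    have bU: "b \<in> squares r U V" "b' \<in> squares r U V" using X Y UV by (auto simp: irr_squares_def)
    have eqij: "b i j + c i j = b' i j + c' i j" for i j using eq' by metis
    have "b i j = b' i j \<and> c i j = c' i j" for i j
      using eqij[of i j] squares_outside[OF bU(1), of i j] squares_outside[OF bU(2), of i j]
       squares_outside[OF X(5), of i j] squares_outside[OF Y(5)[unfolded UV], of i j]
      by (cases "i \<in> U") auto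
    then show "x = y" using xd yd UV by (auto intro!: ext)
  qed
  have img: "?f ` Sigma ?P ?Q = squares r S T"
  proof
    show "?f ` Sigma ?P ?Q \<subseteq> squares r S T"
      using fin by (auto intro!: squares_add simp: irr_squares_def)
    show "squares r S T \<subseteq> ?f ` Sigma ?P ?Q"
    proof
      fix a assume a: "a \<in> squares r S T"
      obtain U V where UV: "(U, V) \<in> comps S T a" "i0 \<in> U" using comps_cover[OF a fin i0] .
      then have c: "closed_pair a U V" "U \<subseteq> S" "V \<subseteq> T" by (auto simp: comps_def)
      have "(\<lambda>i j. if i \<in> U then a i j else 0) \<in> irr_squares r U V"
        using comps_restrict_irr[OF a fin UV(1)] .
      moreover have "(\<lambda>i j. if i \<in> S - U then a i j else 0) \<in> squares r (S - U) (T - V)"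
        using closed_pair_Diff(2)[OF a c(1,1)] by (intro squares_restrict[OF a _ _ _ fin]) auto
      moreover have "a = (\<lambda>i j. (if i \<in> U then a i j else 0) + (if i \<in> S - U then a i j else 0))"
        using squares_outside[OF a] by (auto intro!: ext)
      ultimately show "a \<in> ?f ` Sigma ?P ?Q"
        using UV c by (intro image_eqI[where x = "((U, V), _, _)"]) auto
    qed
  qed
  have "(\<Sum>a\<in>squares r S T. F a) = (\<Sum>x\<in>Sigma ?P ?Q. F (?f x))"
    unfolding img[symmetric] by (rule sum.reindex[OF inj, unfolded comp_def])
  also have "\<dots> = (\<Sum>p\<in>?P. \<Sum>bc\<in>?Q p. F (?f (p, bc)))"
    by (subst sum.Sigma[OF finP finQ]) (simp add: case_prod_unfold)
  also have "\<dots> = (\<Sum>p\<in>?P. \<Sum>b\<in>irr_squares r (fst p) (snd p). \<Sum>c\<in>squares r (S - fst p) (T - snd p). F (\<lambda>i j. b i j + c i j))"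
    by (intro sum.cong refl) (simp add: sum.cartesian_product case_prod_unfold)
  finally show ?thesis by (simp add: case_prod_unfold)
qed

section \<open>Removing the component of a row\<close>

definition pull_back :: "('c \<Rightarrow> 'a) \<Rightarrow> ('d \<Rightarrow> 'b) \<Rightarrow> 'c set \<Rightarrow> 'd set \<Rightarrow> ('a \<Rightarrow> 'b \<Rightarrow> nat) \<Rightarrow> 'c \<Rightarrow> 'd \<Rightarrow> nat" where
  "pull_back f g S' T' a = (\<lambda>i j. if i \<in> S' \<and> j \<in> T' then a (f i) (g j) else 0)"

lemma pull_back_squares:
  assumes f: "bij_betw f S' S" and g: "bij_betw g T' T" and a: "a \<in> squares r S T"
  shows "pull_back f g S' T' a \<in> squares r S' T'"
proof (rule squaresI)
  fix i j assume "pull_back f g S' T' a i j \<noteq> 0"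
  then show "i \<in> S' \<and> j \<in> T'" by (auto simp: pull_back_def split: if_splits)
next
  fix i assume i: "i \<in> S'"
  then have "f i \<in> S" using f by (auto simp: bij_betw_def)
  then show "(\<Sum>j\<in>T'. pull_back f g S' T' a i j) = r"
    using i sum.reindex_bij_betw[OF g, of "a (f i)"] squaresD(3)[OF a] by (simp add: pull_back_def)
next
  fix j assume j: "j \<in> T'"
  then have "g j \<in> T" using g by (auto simp: bij_betw_def)
  then show "(\<Sum>i\<in>S'. pull_back f g S' T' a i j) = r"
    using j sum.reindex_bij_betw[OF f, of "\<lambda>i. a i (g j)"] squaresD(4)[OF a] by (simp add: pull_back_def)
qed

lemma inj_on_pull_back:
  assumes f: "bij_betw f S' S" and g: "bij_betw g T' T"
  shows "inj_on (pull_back f g S' T') (squares r S T)"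
proof (rule inj_onI, intro ext)
  fix a b i j
  assume ab: "a \<in> squares r S T" "b \<in> squares r S T" and eq: "pull_back f g S' T' a = pull_back f g S' T' b"
  show "a i j = b i j"
  proof (cases "i \<in> S \<and> j \<in> T")
    case True
    then obtain i' j' where "i' \<in> S'" "j' \<in> T'" "i = f i'" "j = g j'"
      using f g by (auto simp: bij_betw_def)
    then show ?thesis using fun_cong[OF fun_cong[OF eq], of i' j'] by (simp add: pull_back_def)
  next
    case False
    then show ?thesis using squares_outside[OF ab(1)] squares_outside[OF ab(2)] by metis
  qed
qed

lemma pull_back_irr_squares:
  assumes f: "bij_betw f S' S" and g: "bij_betw g T' T" and a: "a \<in> irr_squares r S T"
  shows "pull_back f g S' T' a \<in> irr_squares r S' T'"
proof -
  let ?a = "pull_back f g S' T' a"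
  have a1: "a \<in> squares r S T" and a2: "(S, T) \<in> comps S T a" using a by (auto simp: irr_squares_def)
  have 1: "?a \<in> squares r S' T'" using pull_back_squares[OF f g a1] .
  have 2: "U' = S' \<and> V' = T'" if *: "U' \<subseteq> S'" "V' \<subseteq> T'" "U' \<noteq> {}" "closed_pair ?a U' V'" for U' V'
  proof -
    have "closed_pair a (f ` U') (g ` V')"
      unfolding closed_pair_def
    proof (intro allI impI)
      fix i j assume ij: "a i j \<noteq> 0"
      then obtain i' j' where ij': "i' \<in> S'" "j' \<in> T'" "i = f i'" "j = g j'"
        using f g squaresD(1,2)[OF a1 ij] by (auto simp: bij_betw_def)
      then have "i' \<in> U' \<longleftrightarrow> j' \<in> V'" using ij *(4) by (auto simp: closed_pair_def pull_back_def)
      moreover have "i \<in> f ` U' \<longleftrightarrow> i' \<in> U'"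
        using f ij' *(1) by (auto simp: bij_betw_def dest: inj_onD)
      moreover have "j \<in> g ` V' \<longleftrightarrow> j' \<in> V'"
        using g ij' *(2) by (auto simp: bij_betw_def dest: inj_onD)
      ultimately show "i \<in> f ` U' \<longleftrightarrow> j \<in> g ` V'" by simp
    qed
    moreover have "f ` U' \<subseteq> S" "g ` V' \<subseteq> T" using f g *(1,2) by (auto simp: bij_betw_def)
    ultimately have "f ` U' = S" "g ` V' = T" using a2 *(3) by (auto simp: comps_def)
    then show ?thesis using f g *(1,2) by (metis bij_betw_def inj_on_image_eq_iff subset_refl)
  qed
  have "S \<noteq> {}" using a2 by (auto simp: comps_def)
  then have "S' \<noteq> {}" using f by (auto simp: bij_betw_def)
  moreover have "closed_pair ?a S' T'" by (auto simp: closed_pair_def pull_back_def)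
  ultimately have "(S', T') \<in> comps S' T' ?a" using 2 by (auto simp: comps_def)
  then show ?thesis using 1 by (auto simp: irr_squares_def)
qed

lemma finite_irr_squares: "finite S \<Longrightarrow> finite T \<Longrightarrow> finite (irr_squares r S T)"
  by (simp add: irr_squares_def finite_squares)

text \<open>
  Relabelling along bijections in both directions gives injections both ways.
\<close>
lemma card_squares_cong:
  assumes fin: "finite S" "finite T" "finite S'" "finite T'" and card: "card S = card S'" "card T = card T'"
  shows "card (squares r S T) = card (squares r S' T')"
    and "card (irr_squares r S T) = card (irr_squares r S' T')"
proof -
  obtain f where f: "bij_betw f S' S" using finite_same_card_bij fin card by metis
  obtain f' where f': "bij_betw f' S S'" using finite_same_card_bij fin card by metis
  obtain g where g: "bij_betw g T' T" using finite_same_card_bij fin card by metis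
  obtain g' where g': "bij_betw g' T T'" using finite_same_card_bij fin card by metis
  have I: "inj_on (pull_back f g S' T') (irr_squares r S T)" "inj_on (pull_back f' g' S T) (irr_squares r S' T')"
    using inj_on_pull_back[OF f g, of r] inj_on_pull_back[OF f' g', of r]
    by (auto simp: irr_squares_def intro: inj_on_subset)
  show "card (squares r S T) = card (squares r S' T')"
    using card_inj_on_le[OF inj_on_pull_back[OF f g, of r], of "squares r S' T'"]
      card_inj_on_le[OF inj_on_pull_back[OF f' g', of r], of "squares r S T"]
      pull_back_squares[OF f g, of _ r] pull_back_squares[OF f' g', of _ r] finite_squares[OF fin(1,2), of r] finite_squares[OF fin(3,4), of r]
    by (simp add: image_subset_iff le_antisym)
  show "card (irr_squares r S T) = card (irr_squares r S' T')"
    using card_inj_on_le[OF I(1), of "irr_squares r S' T'"]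
      card_inj_on_le[OF I(2), of "irr_squares r S T"]
      pull_back_irr_squares[OF f g, of _ r] pull_back_irr_squares[OF f' g', of _ r] finite_irr_squares[OF fin(1,2), of r] finite_irr_squares[OF fin(3,4), of r]
    by (simp add: image_subset_iff le_antisym)
qed

text \<open>
  Dividing by the number of relabellings of rows and columns turns the counts into coefficients
  of exponential generating functions in two families of labels.
\<close>
definition square_density :: "nat \<Rightarrow> nat \<Rightarrow> real" where
  "square_density r n = card (squares r {..<n} {..<n}) / (fact n)\<^sup>2"

definition irr_density :: "nat \<Rightarrow> nat \<Rightarrow> real" where
  "irr_density r n = card (irr_squares r {..<n} {..<n}) / (fact n)\<^sup>2"

lemma card_squares:
  assumes "finite S" "finite T" "card S = n" "card T = n"
  shows "card (squares r S T) = (fact n)\<^sup>2 * square_density r n"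
    and "card (irr_squares r S T) = (fact n)\<^sup>2 * irr_density r n"
  using card_squares_cong[of S T "{..<n}" "{..<n}" r] assms
  by (auto simp: square_density_def irr_density_def)

lemma sum_subsets_by_card:
  fixes f :: "nat \<Rightarrow> 'c::comm_semiring_1"
  assumes "finite S"
  shows "(\<Sum>U\<in>Pow S. f (card U)) = (\<Sum>k\<le>card S. of_nat (card S choose k) * f k)"
proof -
  have "(\<Sum>U\<in>Pow S. f (card U)) = (\<Sum>k\<le>card S. \<Sum>U\<in>{U \<in> Pow S. card U = k}. f (card U))"
    using assms by (intro sum.group[symmetric]) (auto intro: card_mono)
  also have "\<dots> = (\<Sum>k\<le>card S. of_nat (card S choose k) * f k)"
    using n_subsets[OF assms] by (intro sum.cong refl) (simp add: Pow_def conj_commute)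
  finally show ?thesis .
qed

lemma sum_pointed_subsets_by_card:
  fixes f :: "nat \<Rightarrow> 'c::comm_semiring_1"
  assumes "finite S" "i0 \<in> S"
  shows "(\<Sum>U | U \<subseteq> S \<and> i0 \<in> U. f (card U)) = (\<Sum>k=1..card S. of_nat ((card S - 1) choose (k - 1)) * f k)"
proof -
  have bij: "bij_betw (insert i0) (Pow (S - {i0})) {U. U \<subseteq> S \<and> i0 \<in> U}"
    by (rule bij_betw_byWitness[where f' = "\<lambda>U. U - {i0}"]) (use assms in auto)
  have "(\<Sum>U | U \<subseteq> S \<and> i0 \<in> U. f (card U)) = (\<Sum>U\<in>Pow (S - {i0}). f (card (insert i0 U)))"
    by (rule sum.reindex_bij_betw[OF bij, symmetric])
  also have "\<dots> = (\<Sum>U\<in>Pow (S - {i0}). f (Suc (card U)))"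
    using assms(1) by (intro sum.cong refl arg_cong[of _ _ f] card_insert_disjoint) (auto intro: finite_subset)
  also have "\<dots> = (\<Sum>k\<le>card S - 1. of_nat ((card S - 1) choose k) * f (Suc k))"
    using sum_subsets_by_card[of "S - {i0}" "\<lambda>k. f (Suc k)"] assms by simp
  also have "\<dots> = (\<Sum>k=1..card S. of_nat ((card S - 1) choose (k - 1)) * f k)"
    using assms card_gt_0_iff[of S]
    by (intro sum.reindex_bij_witness[where i = "\<lambda>k. k - 1" and j = Suc]) auto
  finally show ?thesis .
qed

text \<open>
  There are \<open>(n - 1 choose k - 1) * (n choose k)\<close> places for a component of size \<open>k\<close> through a given
  row, which is the fraction \<open>k / n\<close> of all \<open>(n choose k)\<^sup>2\<close> places; the factorials of the
  normalization absorb the rest.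
\<close>
lemma binomial_weight:
  assumes "1 \<le> k" "k \<le> n"
  shows "real n * (real ((n - 1) choose (k - 1)) * (real (n choose k) * (x * (fact k)\<^sup>2 * ((fact (n - k))\<^sup>2 * y))))
    = (fact n)\<^sup>2 * (real k * x * y)"
proof -
  have "n * ((n - 1) choose (k - 1)) = k * (n choose k)"
    using times_binomial_minus1_eq[of k n] assms by simp
  then have 1: "real n * real ((n - 1) choose (k - 1)) = real k * real (n choose k)" by (metis of_nat_mult)
  have 2: "fact n = (fact k * fact (n - k) * real (n choose k))"
    using binomial_fact_lemma[OF assms(2)] by (metis of_nat_fact of_nat_mult)
  have "real n * (real ((n - 1) choose (k - 1)) * (real (n choose k) * (x * (fact k)\<^sup>2 * ((fact (n - k))\<^sup>2 * y))))
     = (real n * real ((n - 1) choose (k - 1))) * (real (n choose k) * (x * (fact k)\<^sup>2 * ((fact (n - k))\<^sup>2 * y)))"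
    by simp
  also have "\<dots> = (fact n)\<^sup>2 * (real k * x * y)"
    unfolding 1 2 by (simp add: power2_eq_square)
  finally show ?thesis .
qed

text \<open>
  The decomposition along the component of a row in normalized form, for an arbitrary statistic \<open>\<Phi>\<close> of
  the component counts. Removing a component of size \<open>k\<close> lowers the \<open>k\<close>-th count by one, and the number
  \<open>w k\<close> is the normalized sum over what remains. It is the coefficient form of the differential
  equation satisfied by the exponential of the generating function of irreducible squares.
\<close>
lemma squares_recursion:
  fixes \<Phi> :: "(nat \<Rightarrow> nat) \<Rightarrow> real"
  assumes fin: "finite S" "finite T" and card: "card S = n" "card T = n" and n: "n > 0" and r: "r > 0"
    and w: "\<And>k S' T'. 1 \<le> k \<Longrightarrow> k \<le> n \<Longrightarrow> S' \<subseteq> S \<Longrightarrow> T' \<subseteq> T \<Longrightarrow> card S' = n - k \<Longrightarrow> card T' = n - k \<Longrightarrow>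
      (\<Sum>c\<in>squares r S' T'. \<Phi> (\<lambda>j. ncomps S' T' c j + (if j = k then 1 else 0))) = (fact (n - k))\<^sup>2 * w k"
  shows "real n * (\<Sum>a\<in>squares r S T. \<Phi> (ncomps S T a)) = (fact n)\<^sup>2 * (\<Sum>k=1..n. real k * irr_density r k * w k)"
proof -
  obtain i0 where i0: "i0 \<in> S" using card(1) n by fastforce
  have *: "(\<Sum>b\<in>irr_squares r U V. \<Sum>c\<in>squares r (S - U) (T - V). \<Phi> (ncomps S T (\<lambda>i j. b i j + c i j)))
    = (if card U = card V then irr_density r (card U) * (fact (card U))\<^sup>2 * ((fact (n - card U))\<^sup>2 * w (card U)) else 0)"
    if UV: "U \<subseteq> S" "V \<subseteq> T" "i0 \<in> U" for U V
  proof (cases "card U = card V")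
    case False
    then have "irr_squares r U V = {}" using squares_card_eq r by (auto simp: irr_squares_def)
    then show ?thesis using False by simp
  next
    case True
    have finUV: "finite U" "finite V" using UV fin finite_subset by auto
    have k: "1 \<le> card U" "card U \<le> n"
      using UV finUV fin card card_mono[OF fin(1) UV(1)] by (auto simp: Suc_le_eq card_gt_0_iff)
    have "(\<Sum>b\<in>irr_squares r U V. \<Sum>c\<in>squares r (S - U) (T - V). \<Phi> (ncomps S T (\<lambda>i j. b i j + c i j)))
      = (\<Sum>b\<in>irr_squares r U V. \<Sum>c\<in>squares r (S - U) (T - V).
           \<Phi> (\<lambda>j. ncomps (S - U) (T - V) c j + (if j = card U then 1 else 0)))"
    proof (intro sum.cong refl arg_cong[of _ _ \<Phi>] ext)
      fix b c k assume "b \<in> irr_squares r U V" "c \<in> squares r (S - U) (T - V)"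
      from ncomps_add[OF this UV(1,2) fin r]
      show "ncomps S T (\<lambda>i j. b i j + c i j) k = ncomps (S - U) (T - V) c k + (if k = card U then 1 else 0)" .
    qed
    also have "\<dots> = (\<Sum>b\<in>irr_squares r U V. (fact (n - card U))\<^sup>2 * w (card U))"
      using k UV finUV card True by (intro sum.cong refl w) (auto simp: card_Diff_subset)
    also have "\<dots> = irr_density r (card U) * (fact (card U))\<^sup>2 * ((fact (n - card U))\<^sup>2 * w (card U))"
      using card_squares(2)[OF finUV refl True[symmetric], of r] by simp
    finally show ?thesis using True by simp
  qed
  have "(\<Sum>a\<in>squares r S T. \<Phi> (ncomps S T a)) =
    (\<Sum>U | U \<subseteq> S \<and> i0 \<in> U. \<Sum>V\<in>Pow T. \<Sum>b\<in>irr_squares r U V. \<Sum>c\<in>squares r (S - U) (T - V). \<Phi> (ncomps S T (\<lambda>i j. b i j + c i j)))"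
    by (subst sum_squares_decompose[OF fin i0 r]) (simp add: sum.cartesian_product)
  also have "\<dots> = (\<Sum>U | U \<subseteq> S \<and> i0 \<in> U. \<Sum>V\<in>Pow T.
       (\<lambda>k. if card U = k then irr_density r (card U) * (fact (card U))\<^sup>2 * ((fact (n - card U))\<^sup>2 * w (card U)) else 0) (card V))"
    using * by (intro sum.cong refl) auto
  also have "\<dots> = (\<Sum>U | U \<subseteq> S \<and> i0 \<in> U. (\<lambda>k. real (n choose k) * (irr_density r k * (fact k)\<^sup>2 * ((fact (n - k))\<^sup>2 * w k))) (card U))"
  proof (intro sum.cong refl)
    fix U assume "U \<in> {U. U \<subseteq> S \<and> i0 \<in> U}"
    then have "card U \<le> n" using card_mono[OF fin(1)] card by auto
    then show "(\<Sum>V\<in>Pow T. (\<lambda>k. if card U = k then irr_density r (card U) * (fact (card U))\<^sup>2 * ((fact (n - card U))\<^sup>2 * w (card U)) else 0) (card V))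
      = (\<lambda>k. real (n choose k) * (irr_density r k * (fact k)\<^sup>2 * ((fact (n - k))\<^sup>2 * w k))) (card U)"
      using sum_subsets_by_card[OF fin(2), of "\<lambda>k. if card U = k then irr_density r (card U) * (fact (card U))\<^sup>2 * ((fact (n - card U))\<^sup>2 * w (card U)) else 0"]
      by (simp add: card if_distrib[of "\<lambda>x. _ * x"] cong: if_cong)
  qed
  also have "\<dots> = (\<Sum>k=1..n. real ((n - 1) choose (k - 1)) * (real (n choose k) * (irr_density r k * (fact k)\<^sup>2 * ((fact (n - k))\<^sup>2 * w k))))"
    by (subst sum_pointed_subsets_by_card[OF fin(1) i0]) (simp add: card)
  finally show ?thesis
    by (simp only: sum_distrib_left) (intro sum.cong refl binomial_weight; simp)
qed

section \<open>The exact law of the component counts\<close>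

text \<open>
  The power series \<open>exp (a X\<^sup>k)\<close>.
\<close>
definition exp_monomial :: "real \<Rightarrow> nat \<Rightarrow> real fps" where
  "exp_monomial a k = Abs_fps (\<lambda>n. if k dvd n then a ^ (n div k) / fact (n div k) else 0)"

lemma exp_term_step: "real (Suc d) * (x ^ Suc d / fact (Suc d)) = x * (x ^ d / fact d)" for x :: real
  by (simp del: of_nat_Suc)

lemma X_deriv_exp_monomial:
  assumes k: "k > 0"
  shows "fps_X * fps_deriv (exp_monomial a k) = fps_const (k * a) * fps_X ^ k * exp_monomial a k"
proof (rule fps_ext)
  fix n
  have L: "(fps_X * fps_deriv (exp_monomial a k)) $ n = real n * exp_monomial a k $ n" by (cases n) auto
  have R: "(fps_const (k * a) * fps_X ^ k * exp_monomial a k) $ n = (if n < k then 0 else k * a * exp_monomial a k $ (n - k))"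
    by (simp add: mult.assoc fps_X_power_mult_nth)
  show "(fps_X * fps_deriv (exp_monomial a k)) $ n = (fps_const (k * a) * fps_X ^ k * exp_monomial a k) $ n"
  proof (cases "n < k")
    case True
    then show ?thesis unfolding L R by (auto simp: exp_monomial_def dest: dvd_imp_le)
  next
    case False
    show ?thesis
    proof (cases "k dvd n")
      case True
      then obtain q where q: "n = k * q" by blast
      with False k obtain p where p: "q = Suc p" by (cases q) auto
      have "n - k = k * p" "n = k * Suc p" using q p by auto
      then have "real n * exp_monomial a k $ n = real k * (real (Suc p) * (a ^ Suc p / fact (Suc p)))"
        using k unfolding \<open>n = k * Suc p\<close>
        by (simp add: exp_monomial_def mult.assoc del: of_nat_Suc power_Suc fact_Suc mult_Suc_right)
      also have "\<dots> = real k * a * exp_monomial a k $ (n - k)"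
        using \<open>n - k = k * p\<close> k unfolding exp_term_step by (simp add: exp_monomial_def)
      finally show ?thesis unfolding L R using False by simp
    next
      case F: False
      then have "\<not> k dvd (n - k)" using False by (meson dvd_diffD dvd_refl not_less)
      then show ?thesis unfolding L R using False F by (simp add: exp_monomial_def)
    qed
  qed
qed

definition square_fps :: "nat \<Rightarrow> real fps" where
  "square_fps r = Abs_fps (square_density r)"

text \<open>
  The image under \<open>X d/dX\<close> of the generating function of irreducible squares of size larger
  than \<open>m\<close>.
\<close>
definition large_irr_fps :: "nat \<Rightarrow> nat \<Rightarrow> real fps" where
  "large_irr_fps r m = Abs_fps (\<lambda>k. if k \<le> m then 0 else real k * irr_density r k)"

text \<open>
  The factors cancel the components of sizes \<open>1, \<dots>, m\<close> from the exponential formula, so that this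
  is the generating function of squares all of whose components are larger than \<open>m\<close>.
\<close>
primrec large_square_fps :: "nat \<Rightarrow> nat \<Rightarrow> real fps" where
  "large_square_fps r 0 = square_fps r"
| "large_square_fps r (Suc m) = large_square_fps r m * exp_monomial (- irr_density r (Suc m)) (Suc m)"

lemma squares_empty: "squares r {} {} = {\<lambda>_ _. 0}"
  by (auto simp: squares_def)

lemma ncomps_empty: "ncomps {} T a k = 0"
proof -
  have "comps {} T a = {}" by (auto simp: comps_def)
  then show ?thesis by (simp add: ncomps_def)
qed

lemma square_density_0 [simp]: "square_density r 0 = 1"
  by (simp add: square_density_def squares_empty)

lemma large_square_fps_0 [simp]: "large_square_fps r m $ 0 = 1"
  by (induction m) (simp_all add: square_fps_def exp_monomial_def)

lemma square_density_recursion: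
  assumes r: "r > 0"
  shows "real n * square_density r n = (\<Sum>k=1..n. real k * irr_density r k * square_density r (n - k))"
proof (cases "n = 0")
  case False
  have "real n * (\<Sum>a\<in>squares r {..<n} {..<n}. (\<lambda>_. 1) (ncomps {..<n} {..<n} a)) =
    (fact n)\<^sup>2 * (\<Sum>k=1..n. real k * irr_density r k * square_density r (n - k))"
  proof (rule squares_recursion)
    fix k S' T' assume "S' \<subseteq> {..<n}" "T' \<subseteq> {..<n}" "card S' = n - k" "card T' = n - k"
    then show "(\<Sum>c\<in>squares r S' T'. (1 :: real)) = (fact (n - k))\<^sup>2 * square_density r (n - k)"
      using card_squares(1)[of S' T' "n - k" r] finite_subset by fastforce
  qed (use r False in auto)
  then show ?thesis by (simp add: square_density_def[of r n])
qed simp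

text \<open>
  Both \<open>square_fps\<close> and the factors satisfy a first-order equation \<open>X G' = D G\<close>, and logarithmic
  derivatives add up under multiplication.
\<close>
lemma X_deriv_large_square_fps:
  assumes r: "r > 0"
  shows "fps_X * fps_deriv (large_square_fps r m) = large_irr_fps r m * large_square_fps r m"
proof (induction m)
  case 0
  show ?case
  proof (rule fps_ext)
    fix n
    have "(large_irr_fps r 0 * large_square_fps r 0) $ n = (\<Sum>k=0..n. large_irr_fps r 0 $ k * square_density r (n - k))"
      by (simp add: fps_mult_nth square_fps_def)
    also have "\<dots> = (\<Sum>k=1..n. large_irr_fps r 0 $ k * square_density r (n - k))"
      by (simp add: sum.atLeast_Suc_atMost large_irr_fps_def)
    also have "\<dots> = real n * square_density r n"
      unfolding square_density_recursion[OF r] by (intro sum.cong) (auto simp: large_irr_fps_def)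
    also have "\<dots> = (fps_X * fps_deriv (large_square_fps r 0)) $ n"
      by (cases n) (simp_all add: square_fps_def)
    finally show "(fps_X * fps_deriv (large_square_fps r 0)) $ n = (large_irr_fps r 0 * large_square_fps r 0) $ n" by simp
  qed
next
  case (Suc m)
  let ?E = "exp_monomial (- irr_density r (Suc m)) (Suc m)"
  have D: "large_irr_fps r (Suc m) = large_irr_fps r m + fps_const (Suc m * (- irr_density r (Suc m))) * fps_X ^ Suc m"
    by (rule fps_ext) (auto simp: large_irr_fps_def fps_X_power_nth le_Suc_eq simp del: power_Suc)
  have "fps_X * fps_deriv (large_square_fps r (Suc m)) =
    (fps_X * fps_deriv (large_square_fps r m)) * ?E + large_square_fps r m * (fps_X * fps_deriv ?E)"
    by (simp add: algebra_simps)
  also have "\<dots> = large_irr_fps r (Suc m) * large_square_fps r (Suc m)"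
    unfolding Suc.IH X_deriv_exp_monomial[OF zero_less_Suc] D
    by (simp add: algebra_simps del: fps_const_mult of_nat_Suc power_Suc)
  finally show ?case .
qed

lemma large_square_fps_recursion:
  assumes r: "r > 0"
  shows "real n * large_square_fps r m $ n = (\<Sum>k | m < k \<and> k \<le> n. real k * irr_density r k * large_square_fps r m $ (n - k))"
proof -
  have "real n * large_square_fps r m $ n = (fps_X * fps_deriv (large_square_fps r m)) $ n" by (cases n) auto
  also have "\<dots> = (\<Sum>k=0..n. large_irr_fps r m $ k * large_square_fps r m $ (n - k))"
    unfolding X_deriv_large_square_fps[OF r] fps_mult_nth ..
  also have "\<dots> = (\<Sum>k | m < k \<and> k \<le> n. real k * irr_density r k * large_square_fps r m $ (n - k))"
    by (intro sum.mono_neutral_cong_right) (auto simp: large_irr_fps_def)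
  finally show ?thesis .
qed

definition profile_weight :: "nat \<Rightarrow> nat \<Rightarrow> (nat \<Rightarrow> nat) \<Rightarrow> real" where
  "profile_weight r m c = (\<Prod>k=1..m. irr_density r k ^ c k / fact (c k))"

text \<open>
  The exact normalized number of squares with \<open>c k\<close> components of size \<open>k\<close> for \<open>1 \<le> k \<le> m\<close>: these
  components occupy \<open>s\<close> rows, and the other \<open>n - s\<close> rows carry a square with only larger components.
\<close>
definition profile_density :: "nat \<Rightarrow> nat \<Rightarrow> (nat \<Rightarrow> nat) \<Rightarrow> nat \<Rightarrow> real" where
  "profile_density r m c n =
     (let s = (\<Sum>k=1..m. k * c k) in
      if s \<le> n then profile_weight r m c * large_square_fps r m $ (n - s) else 0)"

lemma profile_weight_remove:
  assumes k: "k \<in> {1..m}" "c k > 0"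
  shows "irr_density r k * profile_weight r m (c(k := c k - 1)) = real (c k) * profile_weight r m c"
proof -
  have "profile_weight r m c' = irr_density r k ^ c' k / fact (c' k) * (\<Prod>j\<in>{1..m} - {k}. irr_density r j ^ c' j / fact (c' j))" for c'
    unfolding profile_weight_def using k by (subst prod.remove[of _ k]) auto
  note this[of c] this[of "c(k := c k - 1)"]
  moreover have "(\<Prod>j\<in>{1..m} - {k}. irr_density r j ^ (c(k := c k - 1)) j / fact ((c(k := c k - 1)) j)) =
     (\<Prod>j\<in>{1..m} - {k}. irr_density r j ^ c j / fact (c j))" by (intro prod.cong) auto
  moreover obtain d where d: "c k = Suc d" using k(2) by (cases "c k") auto
  ultimately have "real (c k) * profile_weight r m c = real (Suc d) * (irr_density r k ^ Suc d / fact (Suc d)) *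
      (\<Prod>j\<in>{1..m} - {k}. irr_density r j ^ c j / fact (c j))"
    and "profile_weight r m (c(k := c k - 1)) = irr_density r k ^ d / fact d *
      (\<Prod>j\<in>{1..m} - {k}. irr_density r j ^ c j / fact (c j))"
    by (simp_all del: of_nat_Suc power_Suc fact_Suc)
  then show ?thesis unfolding exp_term_step by simp
qed

text \<open>
  The claimed formula satisfies the same recursion as the counts. Write \<open>n = s + (n - s)\<close>. The
  components of size at most \<open>m\<close> contribute \<open>k * c k\<close> each, which adds up to \<open>s\<close>; the larger ones
  contribute \<open>n - s\<close> by the recursion for \<open>large_square_fps\<close>.
\<close>
lemma profile_density_recursion:
  assumes r: "r > 0"
  shows "real n * profile_density r m c n = (\<Sum>k=1..n. real k * irr_density r k *
    (if m < k then profile_density r m c (n - k) else if c k = 0 then 0 else profile_density r m (c(k := c k - 1)) (n - k)))"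
    (is "_ = (\<Sum>k=1..n. real k * irr_density r k * ?w k)")
proof -
  define s where "s = (\<Sum>k=1..m. k * c k)"
  have s_ge: "k * c k \<le> s" if "k \<in> {1..m}" for k
    unfolding s_def using that by (intro member_le_sum) auto
  have s_rem: "(\<Sum>j=1..m. j * (c(k := c k - 1)) j) = s - k" if k: "k \<in> {1..m}" "c k > 0" for k
  proof -
    have "s = k * c k + (\<Sum>j\<in>{1..m}-{k}. j * c j)" unfolding s_def using k by (subst sum.remove[of _ k]) auto
    moreover have "(\<Sum>j=1..m. j * (c(k := c k - 1)) j) = k * (c k - 1) + (\<Sum>j\<in>{1..m}-{k}. j * c j)"
      using k by (subst sum.remove[of _ k]) (auto intro!: sum.cong)
    moreover obtain d where "c k = Suc d" using k(2) by (cases "c k") auto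
    ultimately show ?thesis by simp
  qed
  have pd: "profile_density r m c j = (if s \<le> j then profile_weight r m c * large_square_fps r m $ (j - s) else 0)" for j
    by (simp only: profile_density_def Let_def s_def)
  \<comment> \<open>a factor \<open>c k\<close> comes from \<open>1 / (c k - 1)! = c k / (c k)!\<close>; \<open>n - s\<close> is unchanged, as both drop by \<open>k\<close>\<close>
  have small: "real k * irr_density r k * ?w k = real (k * c k) * profile_density r m c n"
    if k: "k \<in> {1..m}" "k \<le> n" for k
  proof (cases "c k = 0")
    case False
    have "k \<le> k * c k" using False by simp
    then have "k \<le> s" using s_ge[OF k(1)] by linarith
    then have "s - k \<le> n - k \<longleftrightarrow> s \<le> n" "n - k - (s - k) = n - s" using k by auto
    moreover have "profile_density r m (c(k := c k - 1)) (n - k) = (if s - k \<le> n - k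
        then profile_weight r m (c(k := c k - 1)) * large_square_fps r m $ (n - k - (s - k)) else 0)"
      using s_rem[OF k(1)] False by (simp only: profile_density_def Let_def)
    ultimately show ?thesis
      using False k profile_weight_remove[OF k(1), of c r] by (simp add: pd)
  qed (use k in auto)
  have "(\<Sum>k=1..n. real k * irr_density r k * ?w k) =
    (\<Sum>k | 1 \<le> k \<and> k \<le> m \<and> k \<le> n. real k * irr_density r k * ?w k) + (\<Sum>k | m < k \<and> k \<le> n. real k * irr_density r k * ?w k)"
    by (subst sum.union_disjoint[symmetric]) (auto intro!: sum.cong)
  also have "(\<Sum>k | 1 \<le> k \<and> k \<le> m \<and> k \<le> n. real k * irr_density r k * ?w k) =
    (\<Sum>k | 1 \<le> k \<and> k \<le> m \<and> k \<le> n. real (k * c k) * profile_density r m c n)"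
    by (intro sum.cong refl small) auto
  also have "\<dots> = (\<Sum>k=1..m. real (k * c k) * profile_density r m c n)"
  proof (intro sum.mono_neutral_left ballI)
    fix k assume k: "k \<in> {1..m} - {k. 1 \<le> k \<and> k \<le> m \<and> k \<le> n}"
    show "real (k * c k) * profile_density r m c n = 0"
    proof (cases "c k = 0")
      case False
      then have "k \<le> k * c k" by simp
      moreover have "k * c k \<le> s" "n < k" using s_ge[of k] k by auto
      ultimately have "n < s" by linarith
      then show ?thesis by (simp add: pd)
    qed simp
  qed auto
  also have "\<dots> = real s * profile_density r m c n"
    by (simp add: s_def sum_distrib_right)
  also have "(\<Sum>k | m < k \<and> k \<le> n. real k * irr_density r k * ?w k) = real (n - s) * profile_density r m c n"
  proof (cases "s \<le> n")
    case True
    have "(\<Sum>k | m < k \<and> k \<le> n. real k * irr_density r k * ?w k) =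
      (\<Sum>k | m < k \<and> k \<le> n - s. profile_weight r m c * (real k * irr_density r k * large_square_fps r m $ (n - s - k)))"
      using True
      by (intro sum.mono_neutral_cong_right) (auto simp: pd add.commute)
    also have "\<dots> = real (n - s) * profile_density r m c n"
      using True large_square_fps_recursion[OF r, of "n - s" m]
      by (simp add: pd flip: sum_distrib_left)
    finally show ?thesis .
  next
    case False
    then show ?thesis by (auto simp: pd intro!: sum.neutral)
  qed
  also have "real s * profile_density r m c n + real (n - s) * profile_density r m c n = real n * profile_density r m c n"
    by (cases "s \<le> n") (auto simp: pd algebra_simps of_nat_diff)
  finally show ?thesis by simp
qed

text \<open>
  Since the right-hand side depends only on the common cardinality \<open>n\<close>, one strong induction handles
  all index sets at once, including those left over after a component is removed.
\<close>
theorem card_squares_profile: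
  assumes r: "r > 0" and fin: "finite S" "finite T" and card: "card S = n" "card T = n"
  shows "real (card {a \<in> squares r S T. \<forall>k\<in>{1..m}. ncomps S T a k = c k}) = (fact n)\<^sup>2 * profile_density r m c n"
  using fin card
proof (induction n arbitrary: S T c rule: less_induct)
  case (less n)
  have conv: "real (card {a \<in> squares r S T. \<forall>k\<in>{1..m}. ncomps S T a k = c k}) =
     (\<Sum>a\<in>squares r S T. of_bool (\<forall>k\<in>{1..m}. ncomps S T a k = c k))"
    if "finite S" "finite T" for S :: "'a set" and T :: "'b set" and c
    using sum.inter_filter[OF finite_squares[OF that, of r], of "\<lambda>_. 1 :: real" "\<lambda>a. \<forall>k\<in>{1..m}. ncomps S T a k = c k"]
    by (simp only: of_bool_def sum_constant mult_1_right)
  show ?case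
  proof (cases "n = 0")
    case True
    then have "S = {}" "T = {}" using less.prems by auto
    then show ?thesis using True
      by (auto simp: squares_empty ncomps_empty profile_density_def profile_weight_def)
  next
    case False
    let ?w = "\<lambda>k. if m < k then profile_density r m c (n - k)
        else if c k = 0 then 0 else profile_density r m (c(k := c k - 1)) (n - k)"
    have "real n * (\<Sum>a\<in>squares r S T. of_bool (\<forall>k\<in>{1..m}. ncomps S T a k = c k)) =
      (fact n)\<^sup>2 * (\<Sum>k=1..n. real k * irr_density r k * ?w k)"
    proof (rule squares_recursion[OF less.prems _ r])
      fix k S' T' assume k: "1 \<le> k" "k \<le> n" and S': "S' \<subseteq> S" "T' \<subseteq> T" "card S' = n - k" "card T' = n - k"
      have fin': "finite S'" "finite T'" using S' less.prems finite_subset by auto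
      have IH: "(\<Sum>a\<in>squares r S' T'. of_bool (\<forall>k\<in>{1..m}. ncomps S' T' a k = c' k)) =
          (fact (n - k))\<^sup>2 * profile_density r m c' (n - k)" for c'
        using less.IH[OF _ fin' S'(3,4), of c'] k conv[OF fin', of c'] by simp
      let ?e = "\<lambda>a j. ncomps S' T' a j + (if j = k then 1 else 0 :: nat)"
      consider "m < k" | "k \<le> m" "c k = 0" | "k \<le> m" "c k > 0" by linarith
      then show "(\<Sum>a\<in>squares r S' T'. of_bool (\<forall>j\<in>{1..m}. ?e a j = c j)) = (fact (n - k))\<^sup>2 * ?w k"
      proof cases
        case 1
        then have "(\<forall>j\<in>{1..m}. ?e a j = c j) \<longleftrightarrow> (\<forall>j\<in>{1..m}. ncomps S' T' a j = c j)" for a by auto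
        then show ?thesis using IH[of c] 1 by simp
      next
        case 2
        then have "(\<forall>j\<in>{1..m}. ?e a j = c j) \<longleftrightarrow> False" for a using k by force
        then show ?thesis using 2 by (simp only: of_bool_eq sum.neutral_const) simp
      next
        case 3
        then have "(\<forall>j\<in>{1..m}. ?e a j = c j) \<longleftrightarrow> (\<forall>j\<in>{1..m}. ncomps S' T' a j = (c(k := c k - 1)) j)" for a
          using k by (auto split: if_splits)
        then show ?thesis using IH[of "c(k := c k - 1)"] 3 by simp
      qed
    qed (use False in auto)
    then have "real n * (\<Sum>a\<in>squares r S T. of_bool (\<forall>k\<in>{1..m}. ncomps S T a k = c k)) =
      (fact n)\<^sup>2 * (real n * profile_density r m c n)"
      unfolding profile_density_recursion[OF r] .
    then show ?thesis using False conv[OF less.prems(1,2)] by simp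
  qed
qed

section \<open>Limits of the component counts\<close>

lemma square_density_pos: "square_density r n > 0"
proof -
  have "(\<lambda>i j. if i = j \<and> j < n then r else 0) \<in> squares r {..<n} {..<n}"
    by (rule squaresI) (auto simp: if_distrib cong: if_cong split: if_splits)
  then have "card (squares r {..<n} {..<n}) > 0"
    using finite_squares[of "{..<n}" "{..<n}" r] by (auto simp: card_gt_0_iff)
  then show ?thesis by (simp add: square_density_def)
qed

lemma fps_mult_exp_monomial_nth:
  assumes k: "k > 0"
  shows "(u * exp_monomial a k) $ n = (\<Sum>i\<le>n. if k * i \<le> n then a ^ i / fact i * u $ (n - k * i) else 0)"
proof -
  have "(u * exp_monomial a k) $ n = (\<Sum>j=0..n. exp_monomial a k $ j * u $ (n - j))"
    by (subst mult.commute) (simp add: fps_mult_nth)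
  also have "\<dots> = (\<Sum>j | j \<le> n \<and> k dvd j. exp_monomial a k $ j * u $ (n - j))"
    by (intro sum.mono_neutral_right) (auto simp: exp_monomial_def)
  also have "\<dots> = (\<Sum>i | k * i \<le> n. a ^ i / fact i * u $ (n - k * i))"
    using k by (intro sum.reindex_bij_witness[where i = "\<lambda>i. k * i" and j = "\<lambda>j. j div k"])
      (auto simp: exp_monomial_def)
  also have "\<dots> = (\<Sum>i\<le>n. if k * i \<le> n then a ^ i / fact i * u $ (n - k * i) else 0)"
  proof (rule sum.mono_neutral_cong_left)
    have "i \<le> n" if "k * i \<le> n" for i
      using le_trans[of i "k * i" n] k that by simp
    then show "{i. k * i \<le> n} \<subseteq> {..n}" by auto
  qed auto
  finally show ?thesis .
qed

lemma ratio_tendsto_power: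
  fixes h :: "nat \<Rightarrow> real"
  assumes h: "\<And>n. h n > 0" and lim: "(\<lambda>n. h n / h (Suc n)) \<longlonglongrightarrow> \<rho>"
  shows "(\<lambda>n. h n / h (n + j)) \<longlonglongrightarrow> \<rho> ^ j"
proof (induction j)
  case 0
  have "h n / h n = 1" for n using h[of n] by simp
  then show ?case by simp
next
  case (Suc j)
  have "(\<lambda>n. (h n / h (n + j)) * (h (n + j) / h (Suc (n + j)))) \<longlonglongrightarrow> \<rho> ^ j * \<rho>"
    by (intro tendsto_mult Suc.IH LIMSEQ_ignore_initial_segment[OF lim, of j, simplified])
  moreover have eq: "(h n / h (n + j)) * (h (n + j) / h (Suc (n + j))) = h n / h (n + Suc j)" for n
    using h[of "n + j"] by simp
  ultimately show ?case by (simp only: eq power_Suc2)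
qed

lemma ratio_bounded:
  fixes h :: "nat \<Rightarrow> real"
  assumes h: "\<And>n. h n > 0" and lim: "(\<lambda>n. h n / h (Suc n)) \<longlonglongrightarrow> \<rho>"
  obtains R where "R > 0" "\<And>n j. h n \<le> R ^ j * h (n + j)"
proof -
  obtain R where R: "R > 0" "\<And>n. norm (h n / h (Suc n)) \<le> R"
    using convergent_imp_Bseq[OF convergentI[OF lim]] by (auto simp: Bseq_def)
  have step: "h n \<le> R * h (Suc n)" for n
    using R(2)[of n] h[of n] h[of "Suc n"] by (simp add: divide_le_eq)
  have "h n \<le> R ^ j * h (n + j)" for n j
  proof (induction j)
    case (Suc j)
    have "R ^ j * h (n + j) \<le> R ^ j * (R * h (Suc (n + j)))"
      using step[of "n + j"] R(1) by (intro mult_left_mono) auto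
    then show ?case using Suc.IH by (simp add: mult.assoc mult.left_commute)
  qed simp
  then show ?thesis using that R(1) by blast
qed

text \<open>
  The quotient is the series over \<open>i\<close> of \<open>a\<^sup>i / i!\<close> times \<open>u\<^sub>n\<^sub>-\<^sub>k\<^sub>i / h\<^sub>n\<close>, which tends to \<open>L \<rho>\<^sup>k\<^sup>i\<close>. Since the
  consecutive quotients of \<open>h\<close> are bounded by some \<open>R\<close>, the terms are dominated by
  \<open>C (\<bar>a\<bar> R\<^sup>k)\<^sup>i / i!\<close>, and Tannery's theorem allows passing to the limit term by term.
\<close>
lemma tendsto_fps_mult_exp_monomial:
  fixes h :: "nat \<Rightarrow> real"
  assumes h: "\<And>n. h n > 0" and lim: "(\<lambda>n. h n / h (Suc n)) \<longlonglongrightarrow> \<rho>"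
    and u: "(\<lambda>n. u $ n / h n) \<longlonglongrightarrow> L" and k: "k > 0"
  shows "(\<lambda>n. (u * exp_monomial a k) $ n / h n) \<longlonglongrightarrow> L * exp (a * \<rho> ^ k)"
proof -
  define t where "t i n = (if k * i \<le> n then a ^ i / fact i * (u $ (n - k * i) / h n) else 0)" for i n
  obtain R where R: "R > 0" "\<And>n j. h n \<le> R ^ j * h (n + j)" 
    by (rule ratio_bounded[OF h lim]) (rule that)
  obtain C where C: "C > 0" "\<And>n. norm (u $ n / h n) \<le> C"
    using convergent_imp_Bseq[OF convergentI[OF u]] by (auto simp: Bseq_def)
  define M where "M i = C * ((\<bar>a\<bar> * R ^ k) ^ i / fact i)" for i
  have eq: "(u * exp_monomial a k) $ n / h n = (\<Sum>i. t i n)" for n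
  proof -
    have "t i n = 0" if "i \<notin> {..n}" for i
      using le_trans[of i "k * i" n] k that by (auto simp: t_def)
    then have "(\<Sum>i. t i n) = (\<Sum>i\<le>n. t i n)" by (intro suminf_finite) auto
    also have "\<dots> = (u * exp_monomial a k) $ n / h n"
      unfolding fps_mult_exp_monomial_nth[OF k] sum_divide_distrib t_def by (intro sum.cong) auto
    finally show ?thesis by simp
  qed
  have t_lim: "(\<lambda>n. t i n) \<longlonglongrightarrow> L * ((a * \<rho> ^ k) ^ i / fact i)" for i
  \<comment> \<open>shifting \<open>n\<close> by \<open>k * i\<close> removes the truncated subtraction and the case distinction in \<open>t\<close>\<close>
  proof (rule LIMSEQ_offset[where k = "k * i"])
    have "(\<lambda>n. a ^ i / fact i * ((u $ n / h n) * (h n / h (n + k * i)))) \<longlonglongrightarrow> a ^ i / fact i * (L * \<rho> ^ (k * i))"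
      by (intro tendsto_mult tendsto_const u ratio_tendsto_power[OF h lim])
    moreover have eq: "a ^ i / fact i * ((u $ n / h n) * (h n / h (n + k * i))) = t i (n + k * i)" for n
      using h[of n] by (simp add: t_def)
    moreover have eq': "a ^ i / fact i * (L * \<rho> ^ (k * i)) = L * ((a * \<rho> ^ k) ^ i / fact i)"
      by (simp add: power_mult_distrib flip: power_mult)
    ultimately show "(\<lambda>n. t i (n + k * i)) \<longlonglongrightarrow> L * ((a * \<rho> ^ k) ^ i / fact i)"
      by (simp only: eq eq')
  qed
  have t_le: "norm (t i n) \<le> M i" for i n
  proof (cases "k * i \<le> n")
    case True
    then obtain p where p: "n = p + k * i" by (metis add.commute le_Suc_ex)
    have "\<bar>u $ p / h n\<bar> \<le> C * R ^ (k * i)"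
    proof -
      have "\<bar>u $ p\<bar> \<le> C * h p" using C(2)[of p] h[of p] by (simp add: divide_le_eq)
      also have "\<dots> \<le> C * (R ^ (k * i) * h n)" using R(2)[of p "k * i"] C(1) p by (intro mult_left_mono) auto
      finally show ?thesis using h[of n] by (simp add: divide_le_eq mult.assoc)
    qed
    then have "\<bar>a\<bar> ^ i / fact i * \<bar>u $ p / h n\<bar> \<le> \<bar>a\<bar> ^ i / fact i * (C * R ^ (k * i))"
      by (intro mult_left_mono) auto
    then show ?thesis using p by (simp add: t_def M_def abs_mult power_abs power_mult_distrib mult_ac flip: power_mult)
  next
    case False
    then show ?thesis using C(1) R(1) by (simp add: t_def M_def)
  qed
  have "summable M" unfolding M_def
    using summable_exp[of "\<bar>a\<bar> * R ^ k"] by (intro summable_mult) (simp add: field_simps)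
  then have "(\<lambda>n. \<Sum>i. t i n) \<longlonglongrightarrow> (\<Sum>i. L * ((a * \<rho> ^ k) ^ i / fact i))"
    using tannerys_theorem[of t "\<lambda>i. L * ((a * \<rho> ^ k) ^ i / fact i)" sequentially M, OF t_lim] t_le
    by (simp add: case_prod_unfold)
  moreover have "(\<Sum>i. L * ((a * \<rho> ^ k) ^ i / fact i)) = L * exp (a * \<rho> ^ k)"
  proof -
    have "(\<lambda>i. (a * \<rho> ^ k) ^ i / fact i) sums exp (a * \<rho> ^ k)"
      using exp_converges[of "a * \<rho> ^ k"] by (simp add: field_simps)
    then show ?thesis by (intro sums_unique[symmetric] sums_mult)
  qed
  ultimately show ?thesis by (simp add: eq)
qed

lemma large_square_fps_limit:
  assumes lim: "(\<lambda>n. square_density r n / square_density r (Suc n)) \<longlonglongrightarrow> \<rho>"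
  shows "(\<lambda>n. large_square_fps r m $ n / square_density r n) \<longlonglongrightarrow> exp (- (\<Sum>k=1..m. irr_density r k * \<rho> ^ k))"
proof (induction m)
  case 0
  have "square_density r n / square_density r n = 1" for n using square_density_pos[of r n] by simp
  then show ?case by (simp add: square_fps_def)
next
  case (Suc m)
  show ?case
    using tendsto_fps_mult_exp_monomial[OF square_density_pos lim Suc.IH, of "Suc m" "- irr_density r (Suc m)"]
    by (simp add: exp_add[symmetric] exp_diff exp_minus field_simps del: power_Suc)
qed

text \<open>
  The limit is a product of Poisson probabilities with parameters \<open>irr_density r k * \<rho>\<^sup>k\<close>. For \<open>\<rho> = 0\<close>
  all parameters vanish and the product is the point mass at zero, since \<open>0\<^sup>0 = 1\<close>; this lets the
  two cases of the theorem share one argument.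
\<close>
lemma profile_density_limit:
  assumes lim: "(\<lambda>n. square_density r n / square_density r (Suc n)) \<longlonglongrightarrow> \<rho>"
  shows "(\<lambda>n. profile_density r m c n / square_density r n) \<longlonglongrightarrow>
    (\<Prod>k=1..m. (irr_density r k * \<rho> ^ k) ^ c k / fact (c k) * exp (- (irr_density r k * \<rho> ^ k)))"
proof -
  define s where "s = (\<Sum>k=1..m. k * c k)"
  have "(\<lambda>n. profile_density r m c n / square_density r n) \<longlonglongrightarrow>
     profile_weight r m c * (exp (- (\<Sum>k=1..m. irr_density r k * \<rho> ^ k)) * \<rho> ^ s)"
  proof (rule LIMSEQ_offset[where k = s])
    have "(\<lambda>n. profile_weight r m c * ((large_square_fps r m $ n / square_density r n) * (square_density r n / square_density r (n + s))))
       \<longlonglongrightarrow> profile_weight r m c * (exp (- (\<Sum>k=1..m. irr_density r k * \<rho> ^ k)) * \<rho> ^ s)"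
      by (intro tendsto_mult tendsto_const large_square_fps_limit[OF lim] ratio_tendsto_power[OF square_density_pos lim])
    moreover have "profile_density r m c (n + s) = profile_weight r m c * large_square_fps r m $ n" for n
      by (simp only: profile_density_def Let_def s_def) simp
    ultimately show "(\<lambda>n. profile_density r m c (n + s) / square_density r (n + s))
      \<longlonglongrightarrow> profile_weight r m c * (exp (- (\<Sum>k=1..m. irr_density r k * \<rho> ^ k)) * \<rho> ^ s)"
      using square_density_pos[of r] by (simp add: less_imp_neq[symmetric])
  qed
  moreover have "profile_weight r m c * (exp (- (\<Sum>k=1..m. irr_density r k * \<rho> ^ k)) * \<rho> ^ s) =
     (\<Prod>k=1..m. (irr_density r k * \<rho> ^ k) ^ c k / fact (c k) * exp (- (irr_density r k * \<rho> ^ k)))"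
  proof -
    have "\<rho> ^ s = (\<Prod>k=1..m. (\<rho> ^ k) ^ c k)" by (simp add: s_def power_sum power_mult)
    moreover have "exp (- (\<Sum>k=1..m. irr_density r k * \<rho> ^ k)) = (\<Prod>k=1..m. exp (- (irr_density r k * \<rho> ^ k)))"
      by (simp add: exp_sum sum_negf[symmetric])
    ultimately show ?thesis
      by (simp add: profile_weight_def power_mult_distrib mult_ac flip: prod.distrib)
  qed
  ultimately show ?thesis by simp
qed

section \<open>Growth of the number of squares for row sums at least 3\<close>

definition row_choice :: "('a \<Rightarrow> 'b \<Rightarrow> nat) \<Rightarrow> 'a \<Rightarrow> 'b" where
  "row_choice a i = (SOME j. a i j \<noteq> 0)"

text \<open>
  In each row of \<open>I\<close> take one edge out of the chosen cell \<open>(i, row_choice a i)\<close> and replace it by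
  two edges, one from row \<open>i\<close> to the new column \<open>j0\<close> and one from the new row \<open>i0\<close> to the chosen
  column. With \<open>card I = r\<close> the new row and the new column have sum \<open>r\<close>, and all other sums are
  unchanged.
\<close>
definition border :: "'a \<Rightarrow> 'b \<Rightarrow> 'a set \<Rightarrow> ('a \<Rightarrow> 'b \<Rightarrow> nat) \<Rightarrow> 'a \<Rightarrow> 'b \<Rightarrow> nat" where
  "border i0 j0 I a = (\<lambda>i j.
     if i = i0 then (if j = j0 then 0 else \<Sum>k\<in>I. of_bool (j = row_choice a k))
     else if j = j0 then of_bool (i \<in> I) else a i j - of_bool (i \<in> I \<and> j = row_choice a i))"

lemma row_choice:
  assumes "a \<in> squares r S T" "r > 0" "i \<in> S"
  shows "row_choice a i \<in> T" "a i (row_choice a i) \<noteq> 0"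
proof -
  obtain j where "a i j \<noteq> 0" using squares_row_entry[OF assms] by blast
  then show *: "a i (row_choice a i) \<noteq> 0" unfolding row_choice_def by (rule someI)
  show "row_choice a i \<in> T" using squaresD(2)[OF assms(1) *] .
qed

lemma border_add:
  assumes a: "a \<in> squares r S T" and r: "r > 0" and I: "I \<subseteq> S" and i0: "i0 \<notin> S" "j0 \<notin> T"
    and ij: "i \<in> S" "j \<in> T"
  shows "a i j = border i0 j0 I a i j + of_bool (i \<in> I \<and> j = row_choice a i)"
proof -
  have "i \<noteq> i0" "j \<noteq> j0" using ij i0 by auto
  then show ?thesis
    using row_choice(2)[OF a r ij(1)] by (simp add: border_def of_bool_def split: if_split)
qed

lemma border_squares:
  assumes a: "a \<in> squares r S T" and r: "r > 0" and fin: "finite S" "finite T"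
    and I: "I \<subseteq> S" "card I = r" and i0: "i0 \<notin> S" "j0 \<notin> T"
  shows "border i0 j0 I a \<in> squares r (insert i0 S) (insert j0 T)" (is "?b \<in> _")
proof (rule squaresI)
  note rc = row_choice[OF a r]
  have finI: "finite I" using I fin finite_subset by auto
  fix i j assume nz: "?b i j \<noteq> 0"
  show "i \<in> insert i0 S \<and> j \<in> insert j0 T"
  proof (cases "i = i0")
    case True
    then have "j = j0 \<or> (\<exists>k\<in>I. j = row_choice a k)"
      using nz by (auto simp: border_def split: if_splits intro: ccontr)
    then show ?thesis using True rc I by auto
  next
    case False
    then show ?thesis using nz I squaresD(1,2)[OF a, of i j]
      by (auto simp: border_def split: if_splits)
  qed
next
  note rc = row_choice[OF a r]
  have finI: "finite I" using I fin finite_subset by auto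
  fix i assume i: "i \<in> insert i0 S"
  show "(\<Sum>j\<in>insert j0 T. ?b i j) = r"
  proof (cases "i = i0")
    case True
    have "(\<Sum>j\<in>insert j0 T. ?b i j) = (\<Sum>j\<in>T. \<Sum>k\<in>I. of_bool (j = row_choice a k))"
      using True i0 fin by (auto simp: border_def intro!: sum.cong)
    also have "\<dots> = (\<Sum>k\<in>I. \<Sum>j\<in>T. of_bool (j = row_choice a k))" by (rule sum.swap)
    also have "\<dots> = (\<Sum>k\<in>I. 1)"
      using rc I fin by (intro sum.cong refl) (auto simp: of_bool_def)
    finally show ?thesis using I by simp
  next
    case False
    then have iS: "i \<in> S" using i by simp
    have "r = (\<Sum>j\<in>T. a i j)" using squaresD(3)[OF a iS] by simp
    also have "\<dots> = (\<Sum>j\<in>T. ?b i j + of_bool (i \<in> I \<and> j = row_choice a i))"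
      using border_add[OF a r I(1) i0 iS] by (intro sum.cong) auto
    also have "\<dots> = (\<Sum>j\<in>T. ?b i j) + of_bool (i \<in> I)"
      using rc[OF iS] fin by (simp add: sum.distrib of_bool_def)
    also have "of_bool (i \<in> I) = ?b i j0" using False by (simp add: border_def)
    finally show ?thesis using i0 fin by simp
  qed
next
  note rc = row_choice[OF a r]
  have finI: "finite I" using I fin finite_subset by auto
  fix j assume j: "j \<in> insert j0 T"
  show "(\<Sum>i\<in>insert i0 S. ?b i j) = r"
  proof (cases "j = j0")
    case True
    have "(\<Sum>i\<in>insert i0 S. ?b i j) = (\<Sum>i\<in>S. ?b i j)"
      using True i0 fin by (simp add: border_def)
    also have "\<dots> = (\<Sum>i\<in>S. of_bool (i \<in> I))"
      using True i0 by (intro sum.cong refl) (auto simp: border_def)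
    also have "\<dots> = card (S \<inter> I)" using fin by (simp add: of_bool_def sum.If_cases)
    finally show ?thesis using I by (simp add: Int_absorb1)
  next
    case False
    then have jT: "j \<in> T" using j by simp
    have "r = (\<Sum>i\<in>S. a i j)" using squaresD(4)[OF a jT] by simp
    also have "\<dots> = (\<Sum>i\<in>S. ?b i j + of_bool (i \<in> I \<and> j = row_choice a i))"
      using border_add[OF a r I(1) i0 _ jT] by (intro sum.cong) auto
    also have "\<dots> = (\<Sum>i\<in>S. ?b i j) + (\<Sum>i\<in>S. of_bool (i \<in> I \<and> j = row_choice a i))"
      by (simp add: sum.distrib)
    also have "(\<Sum>i\<in>S. of_bool (i \<in> I \<and> j = row_choice a i)) = (\<Sum>i\<in>I. of_bool (j = row_choice a i) :: nat)"
      using I fin by (intro sum.mono_neutral_cong_right) auto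
    also have "\<dots> = ?b i0 j" using False by (simp add: border_def)
    finally show ?thesis using i0 fin by simp
  qed
qed

lemma card_nonzero_le_sum:
  fixes f :: "'a \<Rightarrow> nat"
  assumes "finite A"
  shows "card {x \<in> A. f x \<noteq> 0} \<le> sum f A"
proof -
  have "card {x \<in> A. f x \<noteq> 0} = (\<Sum>x\<in>{x \<in> A. f x \<noteq> 0}. 1)" by simp
  also have "\<dots> \<le> (\<Sum>x\<in>{x \<in> A. f x \<noteq> 0}. f x)" by (intro sum_mono) auto
  also have "\<dots> \<le> sum f A" using assms by (intro sum_mono2) auto
  finally show ?thesis .
qed

text \<open>
  There are \<open>card S choose r\<close> sets \<open>I\<close> along which a square can be extended. From the extended
  square, \<open>I\<close> is read off in column \<open>j0\<close>, and the original square is recovered once the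
  chosen columns are known; these lie in the support of row \<open>i0\<close>, so that there are at most \<open>r\<^sup>r\<close> options
  for them.
\<close>
lemma card_squares_border:
  assumes r: "r > 0" and fin: "finite S" "finite T" and i0: "i0 \<notin> S" "j0 \<notin> T"
  shows "card (squares r S T) * (card S choose r) \<le> r ^ r * card (squares r (insert i0 S) (insert j0 T))"
proof -
  let ?D = "squares r S T \<times> {I. I \<subseteq> S \<and> card I = r}"
  let ?Q = "squares r (insert i0 S) (insert j0 T)"
  let ?J = "\<lambda>b. {i \<in> S. b i j0 \<noteq> 0} \<rightarrow>\<^sub>E {j \<in> T. b i0 j \<noteq> 0}"
  let ?f = "\<lambda>(a, I). (border i0 j0 I a, restrict (row_choice a) I)"
  have finQ: "finite ?Q" using fin by (intro finite_squares) auto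
  have finJ: "finite (?J b)" for b using fin by (intro finite_PiE) auto
  \<comment> \<open>column \<open>j0\<close> of the extended square remembers \<open>I\<close>\<close>
  have IJ: "{i \<in> S. border i0 j0 I a i j0 \<noteq> 0} = I" if "I \<subseteq> S" for I and a :: "'a \<Rightarrow> 'b \<Rightarrow> nat"
    using that i0 by (auto simp: border_def)
  have "inj_on ?f ?D"
  proof (rule inj_onI)
    fix x y assume x: "x \<in> ?D" and y: "y \<in> ?D" and eq: "?f x = ?f y"
    obtain a I a' I' where xy: "x = (a, I)" "y = (a', I')" by (metis surj_pair)
    have X: "a \<in> squares r S T" "I \<subseteq> S" and Y: "a' \<in> squares r S T" "I' \<subseteq> S" using x y xy by auto
    have b: "border i0 j0 I a = border i0 j0 I' a'" and c: "restrict (row_choice a) I = restrict (row_choice a') I'"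
      using eq xy by auto
    have I: "I' = I" using IJ[OF X(2), of a] IJ[OF Y(2), of a'] b by simp
    have c': "row_choice a i = row_choice a' i" if "i \<in> I" for i
      using fun_cong[OF c, of i] that I by simp
    have "a i j = a' i j" for i j
    proof (cases "i \<in> S \<and> j \<in> T")
      case True
      then show ?thesis
        using border_add[OF X(1) r X(2) i0, of i j] border_add[OF Y(1) r Y(2) i0, of i j] b I c'[of i] by auto
    next
      case False
      then show ?thesis using squares_outside[OF X(1)] squares_outside[OF Y(1)] by metis
    qed
    then show "x = y" using xy I by auto
  qed
  moreover have "?f ` ?D \<subseteq> Sigma ?Q ?J"
  proof
    fix z assume "z \<in> ?f ` ?D"
    then obtain a I where z: "z = ?f (a, I)" and a: "a \<in> squares r S T" and I: "I \<subseteq> S" "card I = r" by auto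
    have fI: "finite I" using I fin finite_subset by auto
    have "border i0 j0 I a i0 (row_choice a i) \<noteq> 0" if "i \<in> I" for i
      using that row_choice(1)[OF a r, of i] I fI i0 by (auto simp: border_def card_gt_0_iff)
    then have "restrict (row_choice a) I \<in> ?J (border i0 j0 I a)"
      unfolding IJ[OF I(1)] using row_choice(1)[OF a r] I(1) by auto
    then show "z \<in> Sigma ?Q ?J" using z border_squares[OF a r fin I i0] by auto
  qed
  ultimately have "card ?D \<le> card (Sigma ?Q ?J)"
    by (intro card_inj_on_le[of ?f] finite_SigmaI finQ finJ)
  also have "\<dots> = (\<Sum>b\<in>?Q. card (?J b))" by (intro card_SigmaI finQ ballI finJ)
  also have "\<dots> \<le> (\<Sum>b\<in>?Q. r ^ r)"
  proof (intro sum_mono)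
    fix b assume b: "b \<in> ?Q"
    have "card {i \<in> S. b i j0 \<noteq> 0} \<le> card {i \<in> insert i0 S. b i j0 \<noteq> 0}" using fin by (intro card_mono) auto
    also have "\<dots> \<le> r" using card_nonzero_le_sum[of "insert i0 S" "\<lambda>i. b i j0"] squaresD(4)[OF b, of j0] fin by simp
    finally have 1: "card {i \<in> S. b i j0 \<noteq> 0} \<le> r" .
    have "card {j \<in> T. b i0 j \<noteq> 0} \<le> card {j \<in> insert j0 T. b i0 j \<noteq> 0}" using fin by (intro card_mono) auto
    also have "\<dots> \<le> r" using card_nonzero_le_sum[of "insert j0 T" "\<lambda>j. b i0 j"] squaresD(3)[OF b, of i0] fin by simp
    finally have 2: "card {j \<in> T. b i0 j \<noteq> 0} \<le> r" .
    have "card (?J b) = card {j \<in> T. b i0 j \<noteq> 0} ^ card {i \<in> S. b i j0 \<noteq> 0}" using fin by (subst card_PiE) auto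
    also have "\<dots> \<le> r ^ card {i \<in> S. b i j0 \<noteq> 0}" using 2 by (intro power_mono) auto
    also have "\<dots> \<le> r ^ r" using 1 r by (intro power_increasing) auto
    finally show "card (?J b) \<le> r ^ r" .
  qed
  finally show ?thesis using n_subsets[OF fin(1), of r] by (simp add: card_cartesian_product mult.commute)
qed

text \<open>
  The border construction gives a quotient of order at most \<open>n\<^sup>2 / n\<^sup>r\<close>.
\<close>
lemma square_density_ratio_ge_3:
  assumes r: "r \<ge> 3"
  shows "(\<lambda>n. square_density r n / square_density r (Suc n)) \<longlonglongrightarrow> 0"
proof (rule tendsto_sandwich)
  show "\<forall>\<^sub>F n in sequentially. 0 \<le> square_density r n / square_density r (Suc n)"
    using square_density_pos[of r] by (intro always_eventually allI) (simp add: less_imp_le)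
  show "(\<lambda>_. 0) \<longlonglongrightarrow> (0 :: real)" by simp
  let ?g = "\<lambda>n. real r ^ r * (real (Suc n))\<^sup>2 / (real n / real r) ^ 3"
  show "?g \<longlonglongrightarrow> 0" using r by real_asymp
  show "\<forall>\<^sub>F n in sequentially. square_density r n / square_density r (Suc n) \<le> ?g n"
  proof (rule eventually_mono[OF eventually_ge_at_top[of r]])
    fix n assume n: "n \<ge> r"
    let ?a = "real (card (squares r {..<n} {..<n}))" and ?b = "real (card (squares r {..<Suc n} {..<Suc n}))"
    have "(real n / real r) ^ 3 \<le> (real n / real r) ^ r" using r n by (intro power_increasing) auto
    also have "\<dots> \<le> real (n choose r)" using binomial_ge_n_over_k_pow_k[of r n, where 'a = real] n by simp
    finally have C: "(real n / real r) ^ 3 \<le> real (n choose r)" .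
    have "?a * real (n choose r) \<le> real r ^ r * ?b"
      using card_squares_border[of r "{..<n}" "{..<n}" n n] r
      by (simp add: lessThan_Suc flip: of_nat_mult of_nat_power)
    moreover have "?a * (real n / real r) ^ 3 \<le> ?a * real (n choose r)" using C by (intro mult_left_mono) auto
    ultimately have main: "?a * (real n / real r) ^ 3 \<le> real r ^ r * ?b" by linarith
    have pos: "?b > 0" "(real n / real r) ^ 3 > 0"
      using square_density_pos[of r "Suc n"] r n by (auto simp: square_density_def zero_less_divide_iff)
    have "square_density r n / square_density r (Suc n) = ?a * (real (Suc n))\<^sup>2 / ?b"
      by (simp add: square_density_def power_mult_distrib del: of_nat_Suc)
    also have "\<dots> \<le> ?g n"
    proof -
      have "?a * (real (Suc n))\<^sup>2 * (real n / real r) ^ 3 = (?a * (real n / real r) ^ 3) * (real (Suc n))\<^sup>2" by simp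
      also have "\<dots> \<le> (real r ^ r * ?b) * (real (Suc n))\<^sup>2" using main by (intro mult_right_mono) auto
      finally show ?thesis using pos by (simp add: divide_le_eq le_divide_eq mult_ac)
    qed
    finally show "square_density r n / square_density r (Suc n) \<le> ?g n" .
  qed
qed

section \<open>Squares with row sums 2\<close>

text \<open>
  An entry equal to \<open>r\<close> is alone in its row and its column, which can therefore be deleted.
\<close>
lemma card_squares_full_entry:
  assumes fin: "finite S" "finite T" and i: "i \<in> S" "j \<in> T"
  shows "card {a \<in> squares r S T. a i j = r} = card (squares r (S - {i}) (T - {j}))"
proof (rule bij_betw_same_card)
  let ?b = "\<lambda>k l. if k = i \<and> l = j then r else 0"
  let ?f = "\<lambda>a k l. if k \<in> S - {i} then a k l else 0 :: nat"
  let ?g = "\<lambda>c k l. ?b k l + c k l"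
  have b: "?b \<in> squares r {i} {j}" by (auto simp: squares_def)
  have cl: "closed_pair a {i} {j}" if a: "a \<in> squares r S T" "a i j = r" for a
  proof -
    have "(\<Sum>l\<in>T - {j}. a i l) = 0" "(\<Sum>k\<in>S - {i}. a k j) = 0"
      using squaresD(3)[OF a(1) i(1)] squaresD(4)[OF a(1) i(2)] a(2) i fin
      by (simp_all add: sum.remove)
    then have "a i l = 0" if "l \<noteq> j" for l
      using that squares_outside[OF a(1), of i l] fin by (cases "l \<in> T") auto
    moreover have "a k j = 0" if "k \<noteq> i" for k
      using that squares_outside[OF a(1), of k j] fin \<open>(\<Sum>k\<in>S - {i}. a k j) = 0\<close> by (cases "k \<in> S") auto
    ultimately show ?thesis unfolding closed_pair_def by (metis singleton_iff)
  qed
  show "bij_betw ?f {a \<in> squares r S T. a i j = r} (squares r (S - {i}) (T - {j}))"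
  proof (rule bij_betw_byWitness[where f' = ?g])
    show "\<forall>a\<in>{a \<in> squares r S T. a i j = r}. ?g (?f a) = a"
    proof (intro ballI ext)
      fix a k l assume a: "a \<in> {a \<in> squares r S T. a i j = r}"
      then show "?g (?f a) k l = a k l"
        using cl[of a] squares_outside[of a r S T k l] by (cases "k = i") (auto simp: closed_pair_def)
    qed
    show "\<forall>c\<in>squares r (S - {i}) (T - {j}). ?f (?g c) = c"
    proof (intro ballI ext)
      fix c k l assume c: "c \<in> squares r (S - {i}) (T - {j})"
      show "?f (?g c) k l = c k l" using squares_outside[OF c, of k l] by auto
    qed
    show "?f ` {a \<in> squares r S T. a i j = r} \<subseteq> squares r (S - {i}) (T - {j})"
    proof
      fix c assume "c \<in> ?f ` {a \<in> squares r S T. a i j = r}"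
      then obtain a where c: "c = ?f a" and a: "a \<in> squares r S T" "a i j = r" by auto
      show "c \<in> squares r (S - {i}) (T - {j})"
        unfolding c using closed_pair_Diff(2)[OF a(1) cl[OF a] cl[OF a]] fin
        by (intro squares_restrict[OF a(1)]) auto
    qed
    show "?g ` squares r (S - {i}) (T - {j}) \<subseteq> {a \<in> squares r S T. a i j = r}"
    proof
      fix a assume "a \<in> ?g ` squares r (S - {i}) (T - {j})"
      then obtain c where a: "a = ?g c" and c: "c \<in> squares r (S - {i}) (T - {j})" by auto
      have "a \<in> squares r S T" unfolding a using i fin by (intro squares_add[OF b c]) auto
      moreover have "a i j = r" unfolding a using squares_outside[OF c, of i j] by simp
      ultimately show "a \<in> {a \<in> squares r S T. a i j = r}" by simp
    qed
  qed
qed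

text \<open>
  The edge from \<open>p\<close> to \<open>q\<close> is replaced by the path \<open>p, j0, i0, q\<close> through a new column \<open>j0\<close> and a new
  row \<open>i0\<close>.
\<close>
definition subdivide :: "'a \<Rightarrow> 'b \<Rightarrow> ('a \<Rightarrow> 'b \<Rightarrow> nat) \<times> 'a \<times> 'b \<Rightarrow> 'a \<Rightarrow> 'b \<Rightarrow> nat" where
  "subdivide i0 j0 = (\<lambda>(a, p, q) i j.
     if i = i0 then (if j = j0 \<or> j = q then 1 else 0)
     else if j = j0 then (if i = p then 1 else 0)
     else a i j - of_bool (i = p \<and> j = q))"

lemma subdivide_eq:
  assumes "a p q \<noteq> 0" "i \<noteq> i0" "j \<noteq> j0"
  shows "a i j = subdivide i0 j0 (a, p, q) i j + of_bool (i = p \<and> j = q)"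
  using assms by (auto simp: subdivide_def)

lemma subdivide_squares:
  assumes a: "a \<in> squares 2 S T" and fin: "finite S" "finite T"
    and i0: "i0 \<notin> S" "j0 \<notin> T" and pq: "a p q \<noteq> 0"
  shows "subdivide i0 j0 (a, p, q) \<in> squares 2 (insert i0 S) (insert j0 T)" (is "?b \<in> _")
proof (rule squaresI)
  have p: "p \<in> S" and q: "q \<in> T" using squaresD(1,2)[OF a pq] .
  then have ne: "q \<noteq> j0" "p \<noteq> i0" using i0 by auto
  show "i \<in> insert i0 S \<and> j \<in> insert j0 T" if "?b i j \<noteq> 0" for i j
    using that p q squaresD(1,2)[OF a, of i j] by (auto simp: subdivide_def split: if_splits)
  show "(\<Sum>j\<in>insert j0 T. ?b i j) = 2" if i: "i \<in> insert i0 S" for i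
  proof (cases "i = i0")
    case True
    have "(\<Sum>j\<in>T. ?b i j) = (\<Sum>j\<in>T. if j = q then 1 else 0)"
      using True i0 by (intro sum.cong) (auto simp: subdivide_def)
    then show ?thesis using True i0 fin q by (simp add: subdivide_def)
  next
    case False
    then have iS: "i \<in> S" using i by simp
    have "2 = (\<Sum>j\<in>T. a i j)" using squaresD(3)[OF a iS] by simp
    also have "\<dots> = (\<Sum>j\<in>T. ?b i j + of_bool (i = p \<and> j = q))"
      by (intro sum.cong refl subdivide_eq) (use pq False i0 in auto)
    also have "\<dots> = (\<Sum>j\<in>T. ?b i j) + of_bool (i = p)"
      using q fin by (simp add: sum.distrib of_bool_def)
    also have "of_bool (i = p) = ?b i j0" using False by (simp add: subdivide_def)
    finally show ?thesis using i0 fin by simp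
  qed
  show "(\<Sum>i\<in>insert i0 S. ?b i j) = 2" if j: "j \<in> insert j0 T" for j
  proof (cases "j = j0")
    case True
    have "(\<Sum>i\<in>S. ?b i j) = (\<Sum>i\<in>S. if i = p then 1 else 0)"
      using True i0 by (intro sum.cong) (auto simp: subdivide_def)
    then show ?thesis using True i0 fin p by (simp add: subdivide_def)
  next
    case False
    then have jT: "j \<in> T" using j by simp
    have "2 = (\<Sum>i\<in>S. a i j)" using squaresD(4)[OF a jT] by simp
    also have "\<dots> = (\<Sum>i\<in>S. ?b i j + of_bool (i = p \<and> j = q))"
      by (intro sum.cong refl subdivide_eq) (use pq False i0 in auto)
    also have "\<dots> = (\<Sum>i\<in>S. ?b i j) + of_bool (j = q)"
      using p fin by (simp add: sum.distrib of_bool_def)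
    also have "of_bool (j = q) = ?b i0 j" using False by (simp add: subdivide_def)
    finally show ?thesis using i0 fin by simp
  qed
qed

lemma unique_other_entry:
  fixes f :: "'a \<Rightarrow> nat"
  assumes "finite A" "x \<in> A" "f x = 1" "sum f A = 2"
  obtains y where "y \<in> A - {x}" "f y = 1" "\<And>z. z \<in> A - {x} \<Longrightarrow> z \<noteq> y \<Longrightarrow> f z = 0"
proof -
  have "sum f (A - {x}) = 1" using assms by (simp add: sum.remove)
  then obtain y where "y \<in> A - {x}" "f y = 1" "\<forall>z\<in>A - {x}. y \<noteq> z \<longrightarrow> f z = 0"
    using sum_eq_1_iff[of "A - {x}" f] assms(1) by auto
  then show ?thesis using that by metis
qed

text \<open>
  If \<open>b i0 j0 = 1\<close>, then \<open>j0\<close> has exactly one further neighbour \<open>p\<close> and \<open>i0\<close> exactly one further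
  neighbour \<open>q\<close>, and contracting the path \<open>p, j0, i0, q\<close> to an edge inverts the subdivision. A double
  edge can be subdivided in only one way, so cells rather than edges are counted.
\<close>
lemma card_squares_entry_1:
  assumes fin: "finite S" "finite T" and i0: "i0 \<notin> S" "j0 \<notin> T"
  shows "card {b \<in> squares 2 (insert i0 S) (insert j0 T). b i0 j0 = 1} =
    (\<Sum>a\<in>squares 2 S T. card {(p, q). a p q \<noteq> 0})"
proof -
  let ?B = "{b \<in> squares 2 (insert i0 S) (insert j0 T). b i0 j0 = 1}"
  let ?D = "Sigma (squares 2 S T) (\<lambda>a. {(p, q). a p q \<noteq> 0})"
  have inj: "inj_on (subdivide i0 j0) ?D"
  proof (rule inj_onI)
    fix x y assume x: "x \<in> ?D" and y: "y \<in> ?D" and eq: "subdivide i0 j0 x = subdivide i0 j0 y"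
    obtain a p q a' p' q' where xy: "x = (a, p, q)" "y = (a', p', q')" by (metis surj_pair)
    have X: "a \<in> squares 2 S T" "a p q \<noteq> 0" and Y: "a' \<in> squares 2 S T" "a' p' q' \<noteq> 0" using x y xy by auto
    have ne: "q \<noteq> j0" "p \<noteq> i0" "q' \<noteq> j0" "p' \<noteq> i0"
      using squaresD(1,2)[OF X(1) X(2)] squaresD(1,2)[OF Y(1) Y(2)] i0 by auto
    have e: "subdivide i0 j0 (a, p, q) i j = subdivide i0 j0 (a', p', q') i j" for i j
      using eq xy by simp
    have q: "q' = q" using e[of i0 q] ne by (auto simp: subdivide_def split: if_splits)
    have p: "p' = p" using e[of p j0] ne by (auto simp: subdivide_def split: if_splits)
    have "a i j = a' i j" for i j
    proof (cases "i \<in> S \<and> j \<in> T")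
      case True
      then have "i \<noteq> i0" "j \<noteq> j0" using i0 by auto
      then show ?thesis
        using subdivide_eq[of a p q i i0 j j0] subdivide_eq[of a' p' q' i i0 j j0] X Y e[of i j] p q by simp
    next
      case False
      then show ?thesis using squares_outside[OF X(1)] squares_outside[OF Y(1)] by metis
    qed
    then show "x = y" using xy p q by auto
  qed
  have img: "subdivide i0 j0 ` ?D = ?B"
  proof
    show "subdivide i0 j0 ` ?D \<subseteq> ?B"
      using subdivide_squares[OF _ fin i0] by (auto simp: subdivide_def[of i0 j0])
    show "?B \<subseteq> subdivide i0 j0 ` ?D"
    proof
      fix b assume "b \<in> ?B"
      then have b: "b \<in> squares 2 (insert i0 S) (insert j0 T)" "b i0 j0 = 1" by auto
      obtain q where "q \<in> insert j0 T - {j0}" "b i0 q = 1"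
        "\<And>z. z \<in> insert j0 T - {j0} \<Longrightarrow> z \<noteq> q \<Longrightarrow> b i0 z = 0"
        using unique_other_entry[of "insert j0 T" j0 "b i0"] squaresD(3)[OF b(1), of i0] fin b(2) by auto
      then have q: "q \<in> T" "b i0 q = 1" "\<And>z. z \<in> T \<Longrightarrow> z \<noteq> q \<Longrightarrow> b i0 z = 0" using i0 by auto
      obtain p where "p \<in> insert i0 S - {i0}" "b p j0 = 1"
        "\<And>z. z \<in> insert i0 S - {i0} \<Longrightarrow> z \<noteq> p \<Longrightarrow> b z j0 = 0"
        using unique_other_entry[of "insert i0 S" i0 "\<lambda>i. b i j0"] squaresD(4)[OF b(1), of j0] fin b(2) by auto
      then have p: "p \<in> S" "b p j0 = 1" "\<And>z. z \<in> S \<Longrightarrow> z \<noteq> p \<Longrightarrow> b z j0 = 0" using i0 by auto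
      define a where "a = (\<lambda>i j. if i \<in> S \<and> j \<in> T then b i j + of_bool (i = p \<and> j = q) else 0)"
      have "a \<in> squares 2 S T"
      proof (rule squaresI)
        show "i \<in> S \<and> j \<in> T" if "a i j \<noteq> 0" for i j using that by (auto simp: a_def split: if_splits)
        show "(\<Sum>j\<in>T. a i j) = 2" if i: "i \<in> S" for i
        proof -
          have "(\<Sum>j\<in>T. a i j) = (\<Sum>j\<in>T. b i j) + of_bool (i = p)"
            using i q fin by (simp add: a_def sum.distrib of_bool_def)
          also have "of_bool (i = p) = b i j0" using p i by auto
          finally show ?thesis using squaresD(3)[OF b(1), of i] i i0 fin by simp
        qed
        show "(\<Sum>i\<in>S. a i j) = 2" if j: "j \<in> T" for j
        proof -
          have "(\<Sum>i\<in>S. a i j) = (\<Sum>i\<in>S. b i j) + of_bool (j = q)"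
            using j p fin by (simp add: a_def sum.distrib of_bool_def)
          also have "of_bool (j = q) = b i0 j" using q j by auto
          finally show ?thesis using squaresD(4)[OF b(1), of j] j i0 fin by simp
        qed
      qed
      moreover have "a p q \<noteq> 0" using p q by (simp add: a_def)
      moreover have "b i j = subdivide i0 j0 (a, p, q) i j" for i j
      proof (cases "i \<in> insert i0 S \<and> j \<in> insert j0 T")
        case True
        then show ?thesis using p q i0 b(2) by (auto simp: subdivide_def a_def)
      next
        case False
        then have "b i j = 0" using squares_outside[OF b(1)] by blast
        then show ?thesis using False p(1) q(1) by (auto simp: subdivide_def a_def)
      qed
      ultimately show "b \<in> subdivide i0 j0 ` ?D"
        by (intro image_eqI[where x = "(a, p, q)"]) auto
    qed
  qed
  have "card ?B = card ?D" unfolding img[symmetric] by (rule card_image[OF inj])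
  also have "\<dots> = (\<Sum>a\<in>squares 2 S T. card {(p, q). a p q \<noteq> 0})"
  proof (intro card_SigmaI finite_squares fin ballI)
    fix a assume a: "a \<in> squares 2 S T"
    show "finite {(p, q). a p q \<noteq> 0}"
      by (rule finite_subset[of _ "S \<times> T"]) (use squaresD(1,2)[OF a] fin in auto)
  qed
  finally show ?thesis .
qed

text \<open>
  Evaluate the sum of row \<open>0\<close> over all squares, which is twice their number. An entry 2 contributes
  \<open>s (n - 1)\<close> squares for each column. Squares with an entry 1 at a given place are subdivisions of
  squares of size \<open>n - 1\<close> at a positive cell; the number of positive cells is \<open>2 (n - 1)\<close> minus
  the number of entries 2, and entries 2 are counted by \<open>s (n - 2)\<close>.
\<close>
lemma squares_2_recursion:
  assumes n: "n \<ge> 1"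
  defines "s \<equiv> \<lambda>n. card (squares 2 {..<n} {..<n})"
  shows "2 * s n + n * (n - 1)\<^sup>2 * s (n - 2) = 2 * n\<^sup>2 * s (n - 1)"
proof -
  let ?Q = "\<lambda>n. squares 2 {..<n::nat} {..<n::nat}"
  have s: "card (squares 2 S T) = s k" if "finite S" "finite T" "card S = k" "card T = k" for S T :: "nat set" and k
    unfolding s_def using that by (intro card_squares_cong) auto
  have cnt: "card {a \<in> ?Q m. P a} = (\<Sum>a\<in>?Q m. of_bool (P a))" for m P
    using sum.inter_filter[of "?Q m" "\<lambda>_. 1 :: nat" P] finite_squares[of "{..<m}" "{..<m}" 2]
    by (simp add: of_bool_def)
  have le2': "a i j = of_bool (a i j = 1) + 2 * of_bool (a i j = 2)" if "a \<in> ?Q m" for a i j m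
    using squares_entry_le[OF that, of i j] by (auto simp: le_Suc_eq numeral_2_eq_2)
  have E2: "card {a \<in> ?Q m. a i j = 2} = s (m - 1)" if "i < m" "j < m" for i j m
    using card_squares_full_entry[of "{..<m}" "{..<m}" i j 2] s[of "{..<m} - {i}" "{..<m} - {j}" "m - 1"] that
    by simp
  have E1: "card {a \<in> ?Q n. a i j = 1} + (n - 1)\<^sup>2 * s (n - 2) = 2 * (n - 1) * s (n - 1)" if ij: "i < n" "j < n" for i j
  proof -
    let ?S = "{..<n} - {i}" and ?T = "{..<n} - {j}"
    have fin: "finite ?S" "finite ?T" and c: "card ?S = n - 1" "card ?T = n - 1" using ij by auto
    have ins: "insert i ?S = {..<n}" "insert j ?T = {..<n}" using ij by auto
    have le2'': "a p q = of_bool (a p q \<noteq> 0) + of_bool (a p q = 2)" if "a \<in> squares 2 ?S ?T" for a p q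
      using squares_entry_le[OF that fin(2), of p q] by (auto simp: le_Suc_eq numeral_2_eq_2)
    have pos: "card {(p, q). a p q \<noteq> 0} + (\<Sum>p\<in>?S. \<Sum>q\<in>?T. of_bool (a p q = 2)) = 2 * (n - 1)"
      if a: "a \<in> squares 2 ?S ?T" for a
    proof -
      have "card {(p, q). a p q \<noteq> 0} = (\<Sum>pq\<in>?S \<times> ?T. of_bool (case pq of (p, q) \<Rightarrow> a p q \<noteq> 0))"
      proof -
        have "{(p, q). a p q \<noteq> 0} = {pq \<in> ?S \<times> ?T. case pq of (p, q) \<Rightarrow> a p q \<noteq> 0}"
          using squaresD(1,2)[OF a] by auto
        then show ?thesis
          using sum.inter_filter[of "?S \<times> ?T" "\<lambda>_. 1 :: nat" "\<lambda>pq. case pq of (p, q) \<Rightarrow> a p q \<noteq> 0"] fin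
          by (simp add: of_bool_def)
      qed
      also have "\<dots> = (\<Sum>p\<in>?S. \<Sum>q\<in>?T. of_bool (a p q \<noteq> 0))"
        by (subst sum.cartesian_product) (intro sum.cong refl, auto)
      finally have "card {(p, q). a p q \<noteq> 0} + (\<Sum>p\<in>?S. \<Sum>q\<in>?T. of_bool (a p q = 2)) =
        (\<Sum>p\<in>?S. \<Sum>q\<in>?T. of_bool (a p q \<noteq> 0) + of_bool (a p q = 2))"
        by (simp only: sum.distrib)
      also have "\<dots> = (\<Sum>p\<in>?S. \<Sum>q\<in>?T. a p q)"
        using le2''[OF a] by (intro sum.cong refl) simp
      also have "\<dots> = (\<Sum>p\<in>?S. 2)" using squaresD(3)[OF a] by (intro sum.cong refl)
      finally show ?thesis using c by simp
    qed
    have "(\<Sum>a\<in>squares 2 ?S ?T. \<Sum>p\<in>?S. \<Sum>q\<in>?T. of_bool (a p q = 2)) =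
       (\<Sum>p\<in>?S. \<Sum>a\<in>squares 2 ?S ?T. \<Sum>q\<in>?T. of_bool (a p q = 2))" by (rule sum.swap)
    also have "\<dots> = (\<Sum>p\<in>?S. \<Sum>q\<in>?T. \<Sum>a\<in>squares 2 ?S ?T. of_bool (a p q = 2))"
      by (intro sum.cong refl sum.swap)
    also have "\<dots> = (\<Sum>p\<in>?S. \<Sum>q\<in>?T. s (n - 2))"
    proof (intro sum.cong refl)
      fix p q assume pq: "p \<in> ?S" "q \<in> ?T"
      have "(\<Sum>a\<in>squares 2 ?S ?T. of_bool (a p q = 2)) = card {a \<in> squares 2 ?S ?T. a p q = 2}"
        using sum.inter_filter[of "squares 2 ?S ?T" "\<lambda>_. 1 :: nat" "\<lambda>a. a p q = 2"] finite_squares[OF fin, of 2]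
        by (simp add: of_bool_def)
      also have "\<dots> = card (squares 2 (?S - {p}) (?T - {q}))" by (rule card_squares_full_entry[OF fin pq])
      also have "\<dots> = s (n - 2)" using fin c pq by (intro s) auto
      finally show "(\<Sum>a\<in>squares 2 ?S ?T. of_bool (a p q = 2)) = s (n - 2)" .
    qed
    also have "\<dots> = (n - 1)\<^sup>2 * s (n - 2)" using c by (simp add: power2_eq_square)
    finally have "card {a \<in> ?Q n. a i j = 1} + (n - 1)\<^sup>2 * s (n - 2) =
      (\<Sum>a\<in>squares 2 ?S ?T. card {(p, q). a p q \<noteq> 0} + (\<Sum>p\<in>?S. \<Sum>q\<in>?T. of_bool (a p q = 2)))"
      using card_squares_entry_1[of ?S ?T i j] fin ins by (simp add: sum.distrib)
    also have "\<dots> = (\<Sum>a\<in>squares 2 ?S ?T. 2 * (n - 1))" using pos by (intro sum.cong refl)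
    also have "\<dots> = 2 * (n - 1) * s (n - 1)" using s[OF fin c] by simp
    finally show ?thesis .
  qed
  have "2 * s n = (\<Sum>a\<in>?Q n. \<Sum>j<n. a 0 j)"
    using squaresD(3)[of _ 2 "{..<n}" "{..<n}" 0] n by (simp add: s_def)
  also have "\<dots> = (\<Sum>a\<in>?Q n. \<Sum>j<n. of_bool (a 0 j = 1) + 2 * of_bool (a 0 j = 2))"
    by (intro sum.cong refl le2') auto
  also have "\<dots> = (\<Sum>j<n. \<Sum>a\<in>?Q n. of_bool (a 0 j = 1) + 2 * of_bool (a 0 j = 2))" by (rule sum.swap)
  also have "\<dots> = (\<Sum>j<n. card {a \<in> ?Q n. a 0 j = 1} + 2 * card {a \<in> ?Q n. a 0 j = 2})"
    unfolding cnt by (simp add: sum.distrib sum_distrib_left)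
  also have "\<dots> = (\<Sum>j<n. card {a \<in> ?Q n. a 0 j = 1} + 2 * s (n - 1))"
    using n by (intro sum.cong refl) (simp add: E2)
  finally have "2 * s n + n * ((n - 1)\<^sup>2 * s (n - 2)) =
     (\<Sum>j<n. card {a \<in> ?Q n. a 0 j = 1} + (n - 1)\<^sup>2 * s (n - 2) + 2 * s (n - 1))"
    by (simp add: sum.distrib)
  also have "\<dots> = (\<Sum>j<n. 2 * (n - 1) * s (n - 1) + 2 * s (n - 1))"
    using n E1[of 0] by (intro sum.cong refl arg_cong2[of _ _ _ _ "(+)"]) auto
  also have "\<dots> = 2 * n\<^sup>2 * s (n - 1)"
    using n by (cases n) (simp_all add: power2_eq_square algebra_simps)
  finally show ?thesis by (simp add: mult.assoc)
qed

lemma square_density_2_recursion: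
  "real (Suc (Suc n)) * square_density 2 (Suc (Suc n)) =
   real (Suc (Suc n)) * square_density 2 (Suc n) - square_density 2 n / 2"
  and square_density_2_1: "square_density 2 (Suc 0) = 1"
proof -
  let ?s = "\<lambda>n. card (squares 2 {..<n} {..<n})"
  have s: "real (?s n) = (fact n)\<^sup>2 * square_density 2 n" for n by (simp add: square_density_def)
  show "square_density 2 (Suc 0) = 1"
    using squares_2_recursion[of 1] by (simp add: square_density_def squares_empty)
  define N where "N = real (Suc (Suc n))"
  define M where "M = real (Suc n)"
  have "real (2 * ?s (Suc (Suc n)) + Suc (Suc n) * (Suc n)\<^sup>2 * ?s n) = real (2 * (Suc (Suc n))\<^sup>2 * ?s (Suc n))"
    using squares_2_recursion[of "Suc (Suc n)"] by simp
  then have "2 * real (?s (Suc (Suc n))) + N * M\<^sup>2 * real (?s n) = 2 * N\<^sup>2 * real (?s (Suc n))"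
    by (simp only: N_def M_def of_nat_add of_nat_mult of_nat_power of_nat_numeral)
  moreover have f: "fact (Suc (Suc n)) = N * (M * fact n)" "fact (Suc n) = M * fact n"
    by (simp_all add: N_def M_def)
  ultimately have "2 * ((N * (M * fact n))\<^sup>2 * square_density 2 (Suc (Suc n))) + N * M\<^sup>2 * ((fact n)\<^sup>2 * square_density 2 n) =
     2 * N\<^sup>2 * ((M * fact n)\<^sup>2 * square_density 2 (Suc n))"
    unfolding s f by simp
  then have "(fact n)\<^sup>2 * M\<^sup>2 * N * (2 * N * square_density 2 (Suc (Suc n)) + square_density 2 n) =
     (fact n)\<^sup>2 * M\<^sup>2 * N * (2 * N * square_density 2 (Suc n))"
    by (simp add: power2_eq_square algebra_simps)
  moreover have "(fact n)\<^sup>2 * M\<^sup>2 * N \<noteq> 0" by (simp add: N_def M_def)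
  ultimately have "2 * N * square_density 2 (Suc (Suc n)) + square_density 2 n = 2 * N * square_density 2 (Suc n)"
    by simp
  then show "real (Suc (Suc n)) * square_density 2 (Suc (Suc n)) =
     real (Suc (Suc n)) * square_density 2 (Suc n) - square_density 2 n / 2"
    unfolding N_def[symmetric] by (simp add: field_simps)
qed

text \<open>
  The recursion gives \<open>h\<^sub>n\<^sub>+\<^sub>2 = h\<^sub>n\<^sub>+\<^sub>1 - h\<^sub>n / (2 (n + 2))\<close>, and the last term is small relative to
  \<open>h\<^sub>n\<^sub>+\<^sub>1\<close> as soon as \<open>h\<^sub>n \<le> 2 h\<^sub>n\<^sub>+\<^sub>1\<close>.
\<close>
lemma square_density_ratio_2:
  "(\<lambda>n. square_density 2 n / square_density 2 (Suc n)) \<longlonglongrightarrow> 1"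
proof -
  let ?h = "square_density 2"
  \<comment> \<open>a crude bound on the previous quotient is enough to control the correction term of the recursion\<close>
  have half: "?h n \<le> 2 * ?h (Suc n)" for n
  proof (induction n)
    case 0
    then show ?case by (simp add: square_density_2_1)
  next
    case (Suc n)
    have "real (Suc (Suc n)) * ?h (Suc (Suc n)) \<ge> real (Suc (Suc n)) * ?h (Suc n) - ?h (Suc n)"
      using square_density_2_recursion[of n] Suc.IH by linarith
    moreover have "real (Suc (Suc n)) * ?h (Suc n) \<ge> 2 * ?h (Suc n)"
      using square_density_pos[of 2 "Suc n"] by (intro mult_right_mono) auto
    ultimately have "real (Suc (Suc n)) * ?h (Suc n) \<le> real (Suc (Suc n)) * (2 * ?h (Suc (Suc n)))" by linarith
    then show ?case by (simp del: of_nat_Suc)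
  qed
  have "(\<lambda>n. ?h (Suc n) / ?h (Suc (Suc n))) \<longlonglongrightarrow> 1"
  proof (rule tendsto_sandwich)
    let ?N = "\<lambda>n. real (Suc (Suc n))"
    have *: "?N n * ?h (Suc (Suc n)) \<le> ?N n * ?h (Suc n)"
      "?N n * ?h (Suc n) - ?h (Suc n) \<le> ?N n * ?h (Suc (Suc n))" for n
      using square_density_2_recursion[of n] half[of n] square_density_pos[of 2 n] by linarith+
    show "\<forall>\<^sub>F n in sequentially. 1 \<le> ?h (Suc n) / ?h (Suc (Suc n))"
      using *(1) square_density_pos[of 2] by (simp add: le_divide_eq del: of_nat_Suc)
    show "\<forall>\<^sub>F n in sequentially. ?h (Suc n) / ?h (Suc (Suc n)) \<le> ?N n / (?N n - 1)"
    proof (intro always_eventually allI)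
      fix n
      have "?h (Suc n) * (?N n - 1) \<le> ?N n * ?h (Suc (Suc n))" using *(2)[of n] by (simp add: algebra_simps)
      then show "?h (Suc n) / ?h (Suc (Suc n)) \<le> ?N n / (?N n - 1)"
        using square_density_pos[of 2 "Suc (Suc n)"]
        by (subst pos_divide_le_eq, simp, subst times_divide_eq_left, subst pos_le_divide_eq) auto
    qed
    show "(\<lambda>_. 1) \<longlonglongrightarrow> (1 :: real)" by simp
    show "(\<lambda>n. ?N n / (?N n - 1)) \<longlonglongrightarrow> 1" by real_asymp
  qed
  then show ?thesis by (rule LIMSEQ_imp_Suc)
qed

text \<open>
  With \<open>D\<close> the series of all \<open>k * irr_density 2 k\<close>, the three-term recursion says that
  \<open>(1 - X) X H' = (X - X\<^sup>2 / 2) H\<close>, while \<open>X H' = D H\<close>; cancelling \<open>H\<close> determines \<open>D\<close>.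
\<close>
lemma irr_density_2:
  "irr_density 2 1 = 1" "k \<ge> 2 \<Longrightarrow> irr_density 2 k = 1 / (2 * real k)"
proof -
  let ?D = "large_irr_fps 2 0" and ?H = "square_fps 2"
  have "(1 - fps_X) * (fps_X * fps_deriv ?H) = (fps_X - fps_const (1/2) * fps_X ^ 2) * ?H"
  proof (rule fps_ext)
    fix n
    have X: "(fps_X * fps_deriv ?H) $ n = real n * square_density 2 n" for n by (cases n) (auto simp: square_fps_def)
    have L: "((1 - fps_X) * (fps_X * fps_deriv ?H)) $ n = real n * square_density 2 n -
        (if n = 0 then 0 else real (n - 1) * square_density 2 (n - 1))"
      unfolding left_diff_distrib mult_1_left fps_sub_nth fps_X_mult_nth[of "fps_X * fps_deriv ?H"] X by simp
    have R: "((fps_X - fps_const (1/2) * fps_X ^ 2) * ?H) $ n = (if n = 0 then 0 else square_density 2 (n - 1)) -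
        (if n < 2 then 0 else square_density 2 (n - 2) / 2)"
      unfolding left_diff_distrib fps_sub_nth mult.assoc fps_mult_left_const_nth fps_X_mult_nth fps_X_power_mult_nth
      by (simp add: square_fps_def)
    consider "n = 0" | "n = Suc 0" | m where "n = Suc (Suc m)" by (cases n; cases "n - 1") auto
    then show "((1 - fps_X) * (fps_X * fps_deriv ?H)) $ n = ((fps_X - fps_const (1/2) * fps_X ^ 2) * ?H) $ n"
    proof cases
      case 3
      then show ?thesis unfolding L R using square_density_2_recursion[of m] by (simp add: algebra_simps)
    next
      case 2
      then show ?thesis unfolding L R by (simp add: square_density_2_1)
    next
      case 1
      then show ?thesis unfolding L R by simp
    qed
  qed
  then have "((1 - fps_X) * ?D) * ?H = (fps_X - fps_const (1/2) * fps_X ^ 2) * ?H"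
    using X_deriv_large_square_fps[of 2 0] by (simp add: mult.assoc)
  \<comment> \<open>power series over a field form an integral domain, so \<open>H\<close> can be cancelled\<close>
  moreover have "?H \<noteq> 0" using large_square_fps_0[of 2 0] by (metis fps_zero_nth large_square_fps.simps(1) zero_neq_one)
  ultimately have eq: "(1 - fps_X) * ?D = fps_X - fps_const (1/2) * fps_X ^ 2" by simp
  have D: "?D $ n - (if n = 0 then 0 else ?D $ (n - 1)) = (if n = 1 then 1 else 0) - (if n = 2 then 1/2 else 0)" for n
    using arg_cong[OF eq, of "\<lambda>f. f $ n"]
    unfolding left_diff_distrib mult_1_left fps_sub_nth fps_X_mult_nth fps_mult_left_const_nth
    by (auto simp: fps_X_power_nth fps_X_nth split: if_splits)
  have D1: "?D $ 1 = 1" using D[of 1] D[of 0] by simp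
  have D2: "?D $ Suc (Suc n) = 1 / 2" for n
  proof (induction n)
    case 0
    then show ?case using D[of 2] D1 by (simp add: numeral_2_eq_2)
  next
    case (Suc n)
    then show ?case using D[of "Suc (Suc (Suc n))"] by simp
  qed
  show "irr_density 2 1 = 1" using D1 by (simp add: large_irr_fps_def)
  show "irr_density 2 k = 1 / (2 * real k)" if "k \<ge> 2"
  proof -
    have k: "Suc (Suc (k - 2)) = k" using that by simp
    show ?thesis using D2[of "k - 2"] that unfolding k by (simp add: large_irr_fps_def field_simps)
  qed
qed

section \<open>Magical squares as matrices\<close>

definition mat_entries :: "nat \<Rightarrow> nat mat \<Rightarrow> nat \<Rightarrow> nat \<Rightarrow> nat" where
  "mat_entries n A = (\<lambda>i j. if i < n \<and> j < n then A $$ (i, j) else 0)"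

lemma bij_betw_mat_entries:
  "bij_betw (mat_entries n) (magical_squares n r) (squares r {..<n} {..<n})"
proof (rule bij_betw_byWitness[where f' = "\<lambda>a. mat n n (\<lambda>(i, j). a i j)"])
  show "\<forall>A\<in>magical_squares n r. mat n n (\<lambda>(i, j). mat_entries n A i j) = A"
    by (auto simp: magical_squares_def mat_entries_def intro!: eq_matI)
  show "\<forall>a\<in>squares r {..<n} {..<n}. mat_entries n (mat n n (\<lambda>(i, j). a i j)) = a"
  proof (intro ballI ext)
    fix a i j assume a: "a \<in> squares r {..<n} {..<n}"
    show "mat_entries n (mat n n (\<lambda>(i, j). a i j)) i j = a i j"
      using squares_outside[OF a, of i j] by (auto simp: mat_entries_def)
  qed
  show "mat_entries n ` magical_squares n r \<subseteq> squares r {..<n} {..<n}"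
    by (auto simp: magical_squares_def mat_entries_def squares_def split: if_splits)
  show "(\<lambda>a. mat n n (\<lambda>(i, j). a i j)) ` squares r {..<n} {..<n} \<subseteq> magical_squares n r"
    by (auto simp: magical_squares_def squares_def)
qed

text \<open>
  Since a full row of the square already has sum \<open>r\<close>, a partial row sum equal to \<open>r\<close> leaves nothing
  outside.
\<close>
lemma closed_pair_iff_sums:
  assumes a: "a \<in> squares r S T" and fin: "finite S" "finite T" and UV: "U \<subseteq> S" "V \<subseteq> T"
  shows "closed_pair a U V \<longleftrightarrow> (\<forall>i\<in>U. (\<Sum>j\<in>V. a i j) = r) \<and> (\<forall>j\<in>V. (\<Sum>i\<in>U. a i j) = r)"
proof
  assume c: "closed_pair a U V"
  note b = squares_restrict[OF a c UV fin]
  have "(\<Sum>j\<in>V. a i j) = r" if "i \<in> U" for i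
    using squaresD(3)[OF b that] that by simp
  moreover have "(\<Sum>i\<in>U. a i j) = r" if "j \<in> V" for j
    using squaresD(4)[OF b that] by simp
  ultimately show "(\<forall>i\<in>U. (\<Sum>j\<in>V. a i j) = r) \<and> (\<forall>j\<in>V. (\<Sum>i\<in>U. a i j) = r)" by blast
next
  assume s: "(\<forall>i\<in>U. (\<Sum>j\<in>V. a i j) = r) \<and> (\<forall>j\<in>V. (\<Sum>i\<in>U. a i j) = r)"
  have row: "a i j = 0" if "i \<in> U" "j \<in> T - V" for i j
  proof -
    have "(\<Sum>j\<in>T. a i j) = (\<Sum>j\<in>T - V. a i j) + (\<Sum>j\<in>V. a i j)" using UV fin by (intro sum.subset_diff) auto
    then have "(\<Sum>j\<in>T - V. a i j) = 0" using s that UV squaresD(3)[OF a, of i] by auto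
    then show ?thesis using that fin by simp
  qed
  have col: "a i j = 0" if "j \<in> V" "i \<in> S - U" for i j
  proof -
    have "(\<Sum>i\<in>S. a i j) = (\<Sum>i\<in>S - U. a i j) + (\<Sum>i\<in>U. a i j)" using UV fin by (intro sum.subset_diff) auto
    then have "(\<Sum>i\<in>S - U. a i j) = 0" using s that UV squaresD(4)[OF a, of j] by auto
    then show ?thesis using that fin by simp
  qed
  show "closed_pair a U V"
    unfolding closed_pair_def
  proof (intro allI impI)
    fix i j assume nz: "a i j \<noteq> 0"
    have "i \<in> S" "j \<in> T" using squaresD(1,2)[OF a nz] .
    moreover have "\<not> (i \<in> U \<and> j \<in> T - V)" "\<not> (j \<in> V \<and> i \<in> S - U)"
      using row[of i j] col[of j i] nz by metis+
    ultimately show "i \<in> U \<longleftrightarrow> j \<in> V" by blast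
  qed
qed

lemma is_component_iff:
  assumes A: "A \<in> magical_squares n r" and r: "r > 0"
  shows "is_component r A (U, V) \<longleftrightarrow>
    U \<noteq> {} \<and> U \<subseteq> {..<n} \<and> V \<subseteq> {..<n} \<and> closed_pair (mat_entries n A) U V"
proof (cases "U \<subseteq> {..<n} \<and> V \<subseteq> {..<n}")
  case True
  let ?a = "mat_entries n A"
  have a: "?a \<in> squares r {..<n} {..<n}" using bij_betwE[OF bij_betw_mat_entries] A by blast
  have dim: "dim_row A = n" "dim_col A = n" using A by (auto simp: magical_squares_def)
  have "(\<Sum>j\<in>V. A $$ (i, j)) = (\<Sum>j\<in>V. ?a i j)" if "i \<in> U" for i
    using that True by (intro sum.cong) (auto simp: mat_entries_def)
  moreover have "(\<Sum>i\<in>U. A $$ (i, j)) = (\<Sum>i\<in>U. ?a i j)" if "j \<in> V" for j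
    using that True by (intro sum.cong) (auto simp: mat_entries_def)
  ultimately have sums: "(\<forall>i\<in>U. (\<Sum>j\<in>V. A $$ (i, j)) = r) \<and> (\<forall>j\<in>V. (\<Sum>i\<in>U. A $$ (i, j)) = r) \<longleftrightarrow>
      closed_pair ?a U V"
    using closed_pair_iff_sums[OF a, of U V] True by simp
  have "V \<noteq> {} \<and> card U = card V" if "U \<noteq> {}" "closed_pair ?a U V"
  proof -
    have "card U = card V"
      using squares_card_eq[OF squares_restrict[OF a that(2)] r] True by simp
    moreover have "card U > 0" using that(1) True finite_subset by (auto simp: card_gt_0_iff)
    ultimately show ?thesis by auto
  qed
  moreover have "is_component r A (U, V) \<longleftrightarrow> U \<noteq> {} \<and> V \<noteq> {} \<and> card U = card V \<and> closed_pair ?a U V"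
    unfolding is_component_def prod.case sums[symmetric] dim using True by blast
  ultimately show ?thesis using True by blast
next
  case False
  then show ?thesis using A by (auto simp: is_component_def magical_squares_def)
qed

lemma chi_eq_ncomps:
  assumes A: "A \<in> magical_squares n r" and r: "r > 0"
  shows "chi r k A = ncomps {..<n} {..<n} (mat_entries n A) k"
proof -
  have "irreducible_component r A (U, V) \<longleftrightarrow> (U, V) \<in> comps {..<n} {..<n} (mat_entries n A)" for U V
  proof -
    have "is_component r A (U', V') \<longleftrightarrow> U' \<noteq> {} \<and> closed_pair (mat_entries n A) U' V'"
      if "U' \<subseteq> U" "V' \<subseteq> V" "U \<subseteq> {..<n}" "V \<subseteq> {..<n}" for U' V'
      using is_component_iff[OF A r, of U' V'] that by (meson order_trans)
    then show ?thesis
      unfolding irreducible_component_def comps_def prod.case mem_Collect_eq prod.inject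
      using is_component_iff[OF A r, of U V] by meson
  qed
  then show ?thesis by (auto simp: chi_def ncomps_def intro!: arg_cong[of _ _ card])
qed

text \<open>
  The coordinate \<open>i\<close> of a sequence records the components of size \<open>i + 1\<close>, hence the shift in the
  argument of \<open>c\<close>.
\<close>
lemma card_chi_profile:
  assumes r: "r > 0"
  shows "real (card {A \<in> magical_squares n r. \<forall>i<m. chi r (Suc i) A = c i}) =
    (fact n)\<^sup>2 * profile_density r m (\<lambda>k. c (k - 1)) n"
proof -
  have Suc: "(\<forall>i<m. f (Suc i) = c i) \<longleftrightarrow> (\<forall>k\<in>{1..m}. f k = c (k - 1))" for f :: "nat \<Rightarrow> nat"
  proof -
    have "{1..m} = Suc ` {..<m}" by (simp add: image_Suc_lessThan)
    then show ?thesis by auto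
  qed
  define Q where "Q a \<longleftrightarrow> (\<forall>k\<in>{1..m}. ncomps {..<n} {..<n} a k = c (k - 1))" for a
  have "(\<forall>i<m. chi r (Suc i) A = c i) \<longleftrightarrow> Q (mat_entries n A)" if "A \<in> magical_squares n r" for A
    unfolding Q_def Suc[symmetric] using chi_eq_ncomps[OF that r] by simp
  then have eq: "{A \<in> magical_squares n r. \<forall>i<m. chi r (Suc i) A = c i} = {A \<in> magical_squares n r. Q (mat_entries n A)}"
    by blast
  have bij: "bij_betw (mat_entries n) {A \<in> magical_squares n r. Q (mat_entries n A)} {a \<in> squares r {..<n} {..<n}. Q a}"
    using bij_betw_mat_entries[of n r] by (auto simp: bij_betw_def intro: inj_on_subset)
  have "card {A \<in> magical_squares n r. \<forall>i<m. chi r (Suc i) A = c i} = card {a \<in> squares r {..<n} {..<n}. Q a}"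
    unfolding eq by (rule bij_betw_same_card[OF bij])
  then show ?thesis using card_squares_profile[OF r, of "{..<n}" "{..<n}" n m "\<lambda>k. c (k - 1)"]
    by (simp add: Q_def)
qed

lemma chi_profile_probability:
  assumes r: "r > 0"
  shows "measure (distr (measure_pmf (pmf_of_set (magical_squares n r))) borel (\<lambda>A i. real (chi r (Suc i) A)))
      (cylinder m (\<lambda>i. real (c i))) = profile_density r m (\<lambda>k. c (k - 1)) n / square_density r n"
proof -
  let ?M = "magical_squares n r"
  have "measure (distr (measure_pmf (pmf_of_set ?M)) borel (\<lambda>A i. real (chi r (Suc i) A))) (cylinder m (\<lambda>i. real (c i))) =
    measure (measure_pmf (pmf_of_set ?M)) {A. \<forall>i<m. chi r (Suc i) A = c i}"
    by (subst measure_distr[OF _ cylinder_borel]) (auto simp: cylinder_def vimage_def)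
  also have "\<dots> = real (card {A \<in> ?M. \<forall>i<m. chi r (Suc i) A = c i}) / real (card ?M)"
    by (subst measure_pmf_of_set[OF magical_squares_nonempty finite_magical_squares]) (simp add: Int_def)
  also have "real (card ?M) = (fact n)\<^sup>2 * square_density r n"
    using bij_betw_same_card[OF bij_betw_mat_entries[of n r]] by (simp add: square_density_def)
  finally show ?thesis using card_chi_profile[OF r] by simp
qed

lemma chi_profile_limit:
  assumes r: "r > 0" and lim: "(\<lambda>n. square_density r n / square_density r (Suc n)) \<longlonglongrightarrow> \<rho>"
  shows "(\<lambda>n. measure (distr (measure_pmf (pmf_of_set (magical_squares n r))) borel (\<lambda>A i. real (chi r (Suc i) A)))
      (cylinder m (\<lambda>i. real (c i)))) \<longlonglongrightarrow>
    (\<Prod>i<m. (irr_density r (Suc i) * \<rho> ^ Suc i) ^ c i / fact (c i) * exp (- (irr_density r (Suc i) * \<rho> ^ Suc i)))"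
proof -
  have "(\<Prod>k=1..m. (irr_density r k * \<rho> ^ k) ^ c (k - 1) / fact (c (k - 1)) * exp (- (irr_density r k * \<rho> ^ k))) =
    (\<Prod>i<m. (irr_density r (Suc i) * \<rho> ^ Suc i) ^ c i / fact (c i) * exp (- (irr_density r (Suc i) * \<rho> ^ Suc i)))"
    by (intro prod.reindex_bij_witness[where i = Suc and j = "\<lambda>k. k - 1"]) auto
  then show ?thesis
    unfolding chi_profile_probability[OF r] using profile_density_limit[OF lim, of m "\<lambda>k. c (k - 1)"] by simp
qed

lemma integer_valued_if_distr_poisson:
  assumes Z: "Z \<in> borel_measurable N" and d: "distr N borel Z = distr (measure_pmf p) borel (real :: nat \<Rightarrow> real)"
  shows "AE \<omega> in N. Z \<omega> \<in> \<nat>"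
    and "measure N {\<omega> \<in> space N. Z \<omega> = real k} = pmf p k"
proof -
  have N: "(\<nat> :: real set) \<in> sets borel" by (intro sets_lborel countable_imp_null_set_lborel borel_closed) (auto simp: closed_Nats)
  have "AE y in distr (measure_pmf p) borel real. y \<in> (\<nat> :: real set)"
    using N by (subst AE_distr_iff) auto
  then have "AE y in distr N borel Z. y \<in> (\<nat> :: real set)" unfolding d .
  then show "AE \<omega> in N. Z \<omega> \<in> \<nat>" using N Z by (subst (asm) AE_distr_iff) auto
  have "measure N {\<omega> \<in> space N. Z \<omega> = real k} = measure (distr N borel Z) {real k}"
    using Z by (subst measure_distr) (auto intro!: arg_cong[of _ _ "measure N"])
  also have "\<dots> = measure (measure_pmf p) {k}"
    unfolding d by (subst measure_distr) (auto intro!: arg_cong[of _ _ "measure (measure_pmf p)"])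
  finally show "measure N {\<omega> \<in> space N. Z \<omega> = real k} = pmf p k" by (simp add: pmf.rep_eq)
qed

theorem theorem2p4:
  fixes r :: nat and N :: "'b measure" and Z :: "nat \<Rightarrow> 'b \<Rightarrow> real"
  assumes "r \<ge> 2"
    and "prob_space N"
    and "r = 2 \<Longrightarrow> prob_space.indep_vars N (\<lambda>_. borel) Z {1..}"
    and "r = 2 \<Longrightarrow> distr N borel (Z 1) = distr (measure_pmf (poisson_pmf 1)) borel real"
    and "\<And>i. r = 2 \<Longrightarrow> i \<ge> 2 \<Longrightarrow>
           distr N borel (Z i) = distr (measure_pmf (poisson_pmf (1 / (2 * real i)))) borel real"
    and "\<And>i \<omega>. r \<ge> 3 \<Longrightarrow> i \<ge> 1 \<Longrightarrow> \<omega> \<in> space N \<Longrightarrow> Z i \<omega> = 0"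
  shows "converges_in_distribution
           (\<lambda>n. measure_pmf (pmf_of_set (magical_squares n r)))
           (\<lambda>n A. \<lambda>i::nat. real (chi r (Suc i) A))
           N (\<lambda>\<omega>. \<lambda>i::nat. Z (Suc i) \<omega>)"
proof -
  interpret prob_space N by fact
  let ?Z = "\<lambda>\<omega> i. Z (Suc i) \<omega>"
  have r: "r > 0" using assms(1) by simp
  have cases: "r = 2 \<or> r \<ge> 3" using assms(1) by auto
  have Z: "Z (Suc i) \<in> borel_measurable N" for i
    using cases
  proof
    assume "r = 2"
    then show ?thesis using assms(3) by (auto simp: indep_vars_def)
  next
    assume "r \<ge> 3"
    then have "Z (Suc i) \<in> borel_measurable N \<longleftrightarrow> (\<lambda>_. 0 :: real) \<in> borel_measurable N"
      using assms(6) by (intro measurable_cong) auto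
    then show ?thesis by simp
  qed
  have Zseq: "?Z \<in> measurable N borel"
    using Z by (rule measurable_coordinatewise_then_product)
  have poisson: "distr N borel (Z (Suc i)) = distr (measure_pmf (poisson_pmf (irr_density 2 (Suc i)))) borel real"
    and pos: "irr_density 2 (Suc i) > 0" if "r = 2" for i
    using assms(4)[OF that] assms(5)[OF that, of "Suc i"] irr_density_2(1) irr_density_2(2)[of "Suc i"]
    by (cases i; simp)+
  have cyl: "measure (distr N borel ?Z) (cylinder m (\<lambda>i. real (c i))) =
      measure N {\<omega> \<in> space N. \<forall>i<m. Z (Suc i) \<omega> = real (c i)}" for m c
    using Zseq by (subst measure_distr[OF _ cylinder_borel])
      (auto simp: cylinder_def intro!: arg_cong[of _ _ "measure N"])
  show ?thesis
    unfolding converges_in_distribution_def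
  proof (rule weakly_converges_if_cylinders)
    show "prob_space (distr (measure_pmf (pmf_of_set (magical_squares n r))) borel (\<lambda>A i. real (chi r (Suc i) A)))" for n
      by (rule prob_space.prob_space_distr[OF prob_space_measure_pmf]) simp
    show "prob_space (distr N borel ?Z)" using Zseq by (rule prob_space_distr)
    show "AE x in distr N borel ?Z. \<forall>i. x i \<in> \<nat>"
      unfolding AE_all_countable
    proof
      fix i
      have "AE \<omega> in N. Z (Suc i) \<omega> \<in> \<nat>"
        using cases
      proof
        assume "r = 2"
        then show ?thesis using integer_valued_if_distr_poisson(1)[OF Z poisson] by blast
      next
        assume "r \<ge> 3"
        then show ?thesis using assms(6) by (intro AE_I2) auto
      qed
      moreover have "closed {x :: nat \<Rightarrow> real. x i \<in> \<nat>}"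
        using closed_vimage[OF closed_Nats continuous_on_product_coordinates[of i]] by (simp add: vimage_def)
      ultimately show "AE x in distr N borel ?Z. x i \<in> \<nat>"
        using Zseq by (subst AE_distr_iff) auto
    qed
    fix m :: nat and c :: "nat \<Rightarrow> nat"
    show "(\<lambda>n. measure (distr (measure_pmf (pmf_of_set (magical_squares n r))) borel (\<lambda>A i. real (chi r (Suc i) A)))
      (cylinder m (\<lambda>i. real (c i)))) \<longlonglongrightarrow> measure (distr N borel ?Z) (cylinder m (\<lambda>i. real (c i)))"
      using cases
    proof
      assume r2: "r = 2"
      have "measure N {\<omega> \<in> space N. \<forall>i<m. Z (Suc i) \<omega> = real (c i)} =
        (\<Prod>i<m. measure N {\<omega> \<in> space N. Z (Suc i) \<omega> = real (c i)})"
      proof (cases "m = 0")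
        case True
        then show ?thesis by (simp add: prob_space)
      next
        case False
        have "prob (\<Inter>k\<in>Suc ` {..<m}. Z k -` {real (c (k - 1))} \<inter> space N) =
            (\<Prod>k\<in>Suc ` {..<m}. prob (Z k -` {real (c (k - 1))} \<inter> space N))"
          using False by (intro indep_varsD[OF assms(3)[OF r2]]) auto
        moreover have "(\<Inter>k\<in>Suc ` {..<m}. Z k -` {real (c (k - 1))} \<inter> space N) =
            {\<omega> \<in> space N. \<forall>i<m. Z (Suc i) \<omega> = real (c i)}"
          using False by auto
        moreover have "(\<Prod>k\<in>Suc ` {..<m}. prob (Z k -` {real (c (k - 1))} \<inter> space N)) =
            (\<Prod>i<m. prob {\<omega> \<in> space N. Z (Suc i) \<omega> = real (c i)})"
          by (subst prod.reindex) (auto intro!: prod.cong arg_cong[of _ _ prob])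
        ultimately show ?thesis by simp
      qed
      also have "\<dots> = (\<Prod>i<m. (irr_density r (Suc i) * 1 ^ Suc i) ^ c i / fact (c i) * exp (- (irr_density r (Suc i) * 1 ^ Suc i)))"
        using integer_valued_if_distr_poisson(2)[OF Z poisson[OF r2]] pos[OF r2]
        by (intro prod.cong refl) (simp add: r2)
      finally show ?thesis
        unfolding cyl using chi_profile_limit[OF r, of 1 m c] square_density_ratio_2 r2 by simp
    next
      assume r3: "r \<ge> 3"
      have "measure N {\<omega> \<in> space N. \<forall>i<m. Z (Suc i) \<omega> = real (c i)} = (if \<forall>i<m. c i = 0 then 1 else 0)"
      proof (cases "\<forall>i<m. c i = 0")
        case True
        then have "{\<omega> \<in> space N. \<forall>i<m. Z (Suc i) \<omega> = real (c i)} = space N" using assms(6)[OF r3] by auto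
        then show ?thesis using True by (simp add: prob_space)
      next
        case False
        then have empty: "{\<omega> \<in> space N. \<forall>i<m. Z (Suc i) \<omega> = real (c i)} = {}" using assms(6)[OF r3] by auto
        show ?thesis unfolding empty using False by simp
      qed
      also have "\<dots> = (\<Prod>i<m. (irr_density r (Suc i) * 0 ^ Suc i) ^ c i / fact (c i) * exp (- (irr_density r (Suc i) * 0 ^ Suc i)))"
        by (auto simp: power_0_left)
      finally show ?thesis
        unfolding cyl using chi_profile_limit[OF r square_density_ratio_ge_3[OF r3], of m c] by simp
    qed
  qed simp_all
qed

end
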